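(* Let $Y,X$ be positive-definite symmetric matrices corresponding to points of $\mathcal{T}(n)$. Thurston's metric $d_{Th}$ on $\mathcal{T}(n)=\mathrm{SL}(n,\mathbb{R})/\mathrm{SO}(n)$ is given by the formula $$d_{Th}(Y,X)=\frac12\max\{\log|\lambda| : \lambda\text{ is an eigenvalue of }XY^{-1}\}.$$
   Context: Let $n\ge2$ and $\mathbb{T}^n=\mathbb{R}^n/\mathbb{Z}^n$. $\mathcal{T}(n)$ is the set of classes $[S,f]$, where $S$ is a flat $n$-torus of volume 1 and $f:S\to\mathbb{T}^n$ is an orientation-preserving homeomorphism; $[S,f]=[S',f']$ iff there is an isometry $h:S\to S'$ with $f'\circ h$ homotopic to $f$. Writing $S=\mathbb{R}^n/\Lambda$ and lifting $f$ to $\tilde f:\mathbb{R}^n\to\mathbb{R}^n$, the vectors $\zeta_i=\tilde f^{-1}(e_i)$ form an ordered basis of $\Lambda$; taking them as the columns of a matrix $g\in\mathrm{SL}(n,\mathbb{R})$ identifies $\mathcal{T}(n)$ with $\mathrm{SL}(n,\mathbb{R})/\mathrm{SO}(n)$. The latter is identified with the space $\mathcal{P}_n$ of real symmetric positive-definite $n\times n$ matrices of determinant 1 by $g\,\mathrm{SO}(n)\mapsto gg^T$. Thurston's metric: $d_{Th}([S,f],[S',f'])=\frac12\log\inf_\phi\mathcal{L}(\phi)$, where $\phi$ ranges over Lipschitz homeomorphisms $S\to S'$ homotopic to $f'^{-1}\circ f$ and $\mathcal{L}(\phi)=\sup_{x,y\in S,\,x\ne y}d_{S'}(\phi(x),\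phi(y))/d_S(x,y)$.
   Formalization: Here d_Th is log inf L, without the factor 1/2 in its definition (with that factor the formula is off by 2), and the basis vectors ζ_i are the rows, not the columns, of g, since with columns gg^T is not well defined on T(n). *)

theory Defs
  imports "HOL-Analysis.Analysis"
begin

section \<open>Flat tori\<close>

text \<open>The index set of the basis is the type \<open>'n\<close> itself; the columns of \<open>B\<close> span the lattice,
  whose covolume, i.e. the volume of the quotient torus, is \<open>\<bar>det B\<bar>\<close>.\<close>

definition unimodular_lattice :: "(real ^ 'n) set \<Rightarrow> bool" where
  "unimodular_lattice \<Lambda> \<longleftrightarrow>
     (\<exists>B :: real ^ 'n ^ 'n. \<bar>det B\<bar> = 1 \<and>
        \<Lambda> = range (\<lambda>k :: int ^ 'n. B *v (\<chi> i. of_int (k $ i))))"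

definition integer_lattice :: "(real ^ 'n) set" where
  "integer_lattice = {x. \<forall>i. x $ i \<in> \<int>}"

definition coset_of :: "(real ^ 'n) set \<Rightarrow> real ^ 'n \<Rightarrow> (real ^ 'n) set" where
  "coset_of \<Lambda> x = (+) x ` \<Lambda>"

text \<open>The points of \<open>\<real>\<^sup>n/\<Lambda>\<close> are the cosets of \<open>\<Lambda>\<close>; the flat distance of two of them is the least
  Euclidean distance between representatives.\<close>

definition flat_torus :: "(real ^ 'n) set \<Rightarrow> (real ^ 'n) set metric" where
  "flat_torus \<Lambda> = metric (range (coset_of \<Lambda>), setdist)"

abbreviation standard_torus :: "(real ^ 'n) set metric" where
  "standard_torus \<equiv> flat_torus integer_lattice"

lemma unimodular_lattice_integer_lattice: "unimodular_lattice integer_lattice"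
proof -
  have "integer_lattice = range (\<lambda>k :: int ^ 'n. mat 1 *v (\<chi> i. real_of_int (k $ i)))"
  proof (intro equalityI subsetI)
    fix x :: "real ^ 'n" assume "x \<in> integer_lattice"
    then have "x = mat 1 *v (\<chi> i. real_of_int ((\<chi> i. \<lfloor>x $ i\<rfloor>) $ i))"
      by (simp add: integer_lattice_def vec_eq_iff)
    then show "x \<in> range (\<lambda>k :: int ^ 'n. mat 1 *v (\<chi> i. real_of_int (k $ i)))"
      by (rule range_eqI)
  qed (auto simp: integer_lattice_def)
  then show ?thesis
    unfolding unimodular_lattice_def by (intro exI[of _ "mat 1"]) simp
qed

lemma
  fixes \<Lambda> :: "(real ^ 'n) set"
  assumes "unimodular_lattice \<Lambda>"
  shows unimodular_lattice_0: "0 \<in> \<Lambda>"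
    and unimodular_lattice_diff: "x \<in> \<Lambda> \<Longrightarrow> y \<in> \<Lambda> \<Longrightarrow> x - y \<in> \<Lambda>"
    and unimodular_lattice_closed: "closed \<Lambda>"
proof -
  obtain B :: "real ^ 'n ^ 'n" where B: "\<bar>det B\<bar> = 1"
    and \<Lambda>: "\<Lambda> = range (\<lambda>k :: int ^ 'n. B *v (\<chi> i. of_int (k $ i)))"
    using assms unfolding unimodular_lattice_def by blast
  have zero: "(\<chi> i. real_of_int ((0 :: int ^ 'n) $ i)) = 0"
    by (simp add: vec_eq_iff)
  show "0 \<in> \<Lambda>"
    unfolding \<Lambda> by (rule range_eqI[of _ _ 0]) (simp add: zero del: zero_index)
  have diff: "B *v (\<chi> i. of_int (k $ i)) - B *v (\<chi> i. of_int (l $ i))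
      = B *v (\<chi> i. of_int ((k - l) $ i))" for k l :: "int ^ 'n"
    unfolding matrix_vector_mult_diff_distrib[symmetric]
    by (rule arg_cong[where f = "(*v) B"]) (simp add: vec_eq_iff)
  show diffL: "x - y \<in> \<Lambda>" if "x \<in> \<Lambda>" "y \<in> \<Lambda>" for x y
    using that unfolding \<Lambda> by (auto simp only: diff)
  have inj: "inj ((*v) B)"
    using B by (intro inj_matrix_vector_mult) (auto simp: invertible_det_nz)
  obtain c where c: "c > 0" "\<And>v. c * norm v \<le> norm (B *v v)"
    using linear_inj_bounded_below_pos[OF matrix_vector_mul_linear inj] by (auto simp: mult.commute)
  have "x = y" if xy: "x \<in> \<Lambda>" "y \<in> \<Lambda>" "norm (x - y) < c" for x y
  proof (rule ccontr)
    assume "x \<noteq> y"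
    obtain k :: "int ^ 'n" where k: "x - y = B *v (\<chi> i. of_int (k $ i))"
      using diffL[OF xy(1,2)] unfolding \<Lambda> by blast
    have "k \<noteq> 0"
    proof
      assume "k = 0"
      then have "x - y = 0" unfolding k using zero by (simp del: zero_index)
      with \<open>x \<noteq> y\<close> show False by simp
    qed
    then obtain i where i: "k $ i \<noteq> 0" by (auto simp: vec_eq_iff)
    then have "1 \<le> \<bar>(\<chi> i. real_of_int (k $ i)) $ i\<bar>"
      by simp
    also have "\<dots> \<le> norm (\<chi> i. real_of_int (k $ i))"
      by (rule component_le_norm_cart)
    finally have "c \<le> c * norm (\<chi> i. real_of_int (k $ i))"
      using c(1) by simp
    also have "\<dots> \<le> norm (x - y)"
      unfolding k by (rule c(2))
    finally show False using xy(3) by simp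
  qed
  then show "closed \<Lambda>"
    using discrete_imp_closed[OF c(1), of \<Lambda>] by (auto simp: dist_norm)
qed

lemma setdist_coset_of:
  assumes "unimodular_lattice \<Lambda>"
  shows "setdist (coset_of \<Lambda> x) (coset_of \<Lambda> y) = infdist (x - y) \<Lambda>"
proof (rule antisym)
  have ne: "\<Lambda> \<noteq> {}" using unimodular_lattice_0[OF assms] by blast
  show "setdist (coset_of \<Lambda> x) (coset_of \<Lambda> y) \<le> infdist (x - y) \<Lambda>"
    unfolding infdist_notempty[OF ne]
  proof (rule cINF_greatest[OF ne])
    fix l assume l: "l \<in> \<Lambda>"
    have "setdist (coset_of \<Lambda> x) (coset_of \<Lambda> y) \<le> dist (x + 0) (y + l)"
      by (rule setdist_le_dist)
        (use l unimodular_lattice_0[OF assms] in \<open>unfold coset_of_def, blast+\<close>)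
    then show "setdist (coset_of \<Lambda> x) (coset_of \<Lambda> y) \<le> dist (x - y) l"
      by (simp add: dist_norm algebra_simps)
  qed
  show "infdist (x - y) \<Lambda> \<le> setdist (coset_of \<Lambda> x) (coset_of \<Lambda> y)"
  proof (rule le_setdistI)
    fix u v assume "u \<in> coset_of \<Lambda> x" "v \<in> coset_of \<Lambda> y"
    then obtain k l where kl: "k \<in> \<Lambda>" "l \<in> \<Lambda>" "u = x + k" "v = y + l"
      unfolding coset_of_def by blast
    have "infdist (x - y) \<Lambda> \<le> dist (x - y) (l - k)"
      by (rule infdist_le) (rule unimodular_lattice_diff[OF assms kl(2,1)])
    then show "infdist (x - y) \<Lambda> \<le> dist u v"
      by (simp add: kl dist_norm algebra_simps)
  qed (use ne in \<open>simp_all add: coset_of_def\<close>)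
qed

lemma coset_of_eq_iff:
  assumes "unimodular_lattice \<Lambda>"
  shows "coset_of \<Lambda> x = coset_of \<Lambda> y \<longleftrightarrow> x - y \<in> \<Lambda>"
proof
  assume "coset_of \<Lambda> x = coset_of \<Lambda> y"
  moreover have "x + 0 \<in> coset_of \<Lambda> x"
    unfolding coset_of_def by (rule imageI) (rule unimodular_lattice_0[OF assms])
  ultimately obtain l where "l \<in> \<Lambda>" "x = y + l" unfolding coset_of_def by auto
  then show "x - y \<in> \<Lambda>" by simp
next
  have sub: "coset_of \<Lambda> x \<subseteq> coset_of \<Lambda> y" if "x - y \<in> \<Lambda>" for x y
  proof
    fix u assume "u \<in> coset_of \<Lambda> x"
    then obtain l where l: "l \<in> \<Lambda>" "u = x + l" unfolding coset_of_def by blast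
    have "(x - y) - (0 - l) \<in> \<Lambda>"
      by (intro unimodular_lattice_diff[OF assms] that l unimodular_lattice_0[OF assms])
    moreover have "u = y + ((x - y) - (0 - l))" using l by simp
    ultimately show "u \<in> coset_of \<Lambda> y" unfolding coset_of_def by (rule rev_image_eqI)
  qed
  assume "x - y \<in> \<Lambda>"
  moreover have "y - x \<in> \<Lambda>"
    using unimodular_lattice_diff[OF assms unimodular_lattice_0[OF assms] calculation] by simp
  ultimately show "coset_of \<Lambda> x = coset_of \<Lambda> y" by (simp add: sub subset_antisym)
qed

lemma Metric_space_flat_torus:
  assumes "unimodular_lattice \<Lambda>"
  shows "Metric_space (range (coset_of \<Lambda>)) setdist"
proof
  have ne: "\<Lambda> \<noteq> {}" using unimodular_lattice_0[OF assms] by blast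
  fix p q r assume "p \<in> range (coset_of \<Lambda>)" "q \<in> range (coset_of \<Lambda>)"
  then obtain x y where xy: "p = coset_of \<Lambda> x" "q = coset_of \<Lambda> y" by blast
  show "setdist p q = 0 \<longleftrightarrow> p = q"
    unfolding xy setdist_coset_of[OF assms] coset_of_eq_iff[OF assms]
    using in_closed_iff_infdist_zero[OF unimodular_lattice_closed[OF assms] ne] by simp
  assume "r \<in> range (coset_of \<Lambda>)"
  then obtain z where z: "r = coset_of \<Lambda> z" by blast
  show "setdist p r \<le> setdist p q + setdist q r"
  proof (rule field_le_epsilon)
    fix e :: real assume "e > 0"
    have dist_lt: "\<exists>l\<in>\<Lambda>. dist w l < infdist w \<Lambda> + e / 2" for w
      using \<open>e > 0\<close> cInf_lessD[of "dist w ` \<Lambda>" "infdist w \<Lambda> + e / 2"] ne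
      by (auto simp: infdist_notempty)
    obtain k l where k: "k \<in> \<Lambda>" "dist (x - y) k < infdist (x - y) \<Lambda> + e / 2"
      and l: "l \<in> \<Lambda>" "dist (y - z) l < infdist (y - z) \<Lambda> + e / 2"
      using dist_lt by meson
    have kl: "k - (0 - l) \<in> \<Lambda>"
      by (intro unimodular_lattice_diff[OF assms] k l unimodular_lattice_0[OF assms])
    have "infdist (x - z) \<Lambda> \<le> dist (x - z) (k - (0 - l))"
      by (rule infdist_le[OF kl])
    also have "\<dots> \<le> dist (x - y) k + dist (y - z) l"
      using norm_triangle_ineq[of "(x - y) - k" "(y - z) - l"]
      by (simp add: dist_norm algebra_simps)
    finally show "setdist p r \<le> setdist p q + setdist q r + e"
      using k(2) l(2) unfolding xy z setdist_coset_of[OF assms] by simp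
  qed
qed (simp_all add: setdist_sym)

lemma
  assumes "unimodular_lattice \<Lambda>"
  shows mspace_flat_torus: "mspace (flat_torus \<Lambda>) = range (coset_of \<Lambda>)"
    and mdist_flat_torus: "mdist (flat_torus \<Lambda>) = setdist"
  using Metric_space.mspace_metric[OF Metric_space_flat_torus[OF assms]]
    Metric_space.mdist_metric[OF Metric_space_flat_torus[OF assms]]
  by (simp_all add: flat_torus_def)


section \<open>Marked flat tori and the Teichmueller space\<close>

definition torus_lift ::
  "(real ^ 'n) set \<Rightarrow> (real ^ 'n) set \<Rightarrow> ((real ^ 'n) set \<Rightarrow> (real ^ 'n) set)
    \<Rightarrow> (real ^ 'n \<Rightarrow> real ^ 'n) \<Rightarrow> bool" where
  "torus_lift \<Lambda> \<Lambda>' f F \<longleftrightarrow>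
     continuous_on UNIV F \<and> (\<forall>x. f (coset_of \<Lambda> x) = coset_of \<Lambda>' (F x))"

text \<open>For a homeomorphism \<open>F\<close> of \<open>\<real>\<^sup>n\<close>, orientation preservation is the condition that
  \<open>x \<mapsto> F x - F 0\<close> has degree 1 on \<open>\<real>\<^sup>n - {0}\<close>; by Hopf's theorem this means that it is
  homotopic to the identity there. The tori carry the orientation induced from \<open>\<real>\<^sup>n\<close>.\<close>

definition orientation_preserving ::
  "(real ^ 'n) set \<Rightarrow> (real ^ 'n) set \<Rightarrow> ((real ^ 'n) set \<Rightarrow> (real ^ 'n) set) \<Rightarrow> bool" where
  "orientation_preserving \<Lambda> \<Lambda>' f \<longleftrightarrow>
     (\<exists>F. torus_lift \<Lambda> \<Lambda>' f F \<and>
        homotopic_with_canon (\<lambda>_. True) (- {0}) (- {0}) (\<lambda>x. F x - F 0) id)"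

type_synonym 'n marking = "(real ^ 'n) set \<times> ((real ^ 'n) set \<Rightarrow> (real ^ 'n) set)"

definition marked_tori :: "'n::finite marking set" where
  "marked_tori =
     {(\<Lambda>, f). unimodular_lattice \<Lambda> \<and>
        homeomorphic_map (mtopology_of (flat_torus \<Lambda>)) (mtopology_of standard_torus) f \<and>
        orientation_preserving \<Lambda> integer_lattice f}"

definition isometry_between :: "'a metric \<Rightarrow> 'b metric \<Rightarrow> ('a \<Rightarrow> 'b) \<Rightarrow> bool" where
  "isometry_between S S' h \<longleftrightarrow>
     bij_betw h (mspace S) (mspace S') \<and>
     (\<forall>x\<in>mspace S. \<forall>y\<in>mspace S. mdist S' (h x) (h y) = mdist S x y)"

definition marking_rel :: "('n::finite marking \<times> 'n marking) set" where
  "marking_rel =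
     {((\<Lambda>, f), (\<Lambda>', f')). (\<Lambda>, f) \<in> marked_tori \<and> (\<Lambda>', f') \<in> marked_tori \<and>
        (\<exists>h. isometry_between (flat_torus \<Lambda>) (flat_torus \<Lambda>') h \<and>
           homotopic_with (\<lambda>_. True) (mtopology_of (flat_torus \<Lambda>)) (mtopology_of standard_torus)
             (f' \<circ> h) f)}"

definition teichmueller_space :: "'n::finite marking set set" where
  "teichmueller_space = marked_tori // marking_rel"


section \<open>Thurston's metric\<close>

definition lipschitz_const :: "'a metric \<Rightarrow> 'b metric \<Rightarrow> ('a \<Rightarrow> 'b) \<Rightarrow> real" where
  "lipschitz_const S S' \<phi> =
     Sup {mdist S' (\<phi> x) (\<phi> y) / mdist S x y | x y. x \<in> mspace S \<and> y \<in> mspace S \<and> x \<noteq> y}"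

definition marking_change_maps ::
  "'n::finite marking \<Rightarrow> 'n marking \<Rightarrow> ((real ^ 'n) set \<Rightarrow> (real ^ 'n) set) set" where
  "marking_change_maps = (\<lambda>(\<Lambda>, f) (\<Lambda>', f').
     {\<phi>. homeomorphic_map (mtopology_of (flat_torus \<Lambda>)) (mtopology_of (flat_torus \<Lambda>')) \<phi> \<and>
        Lipschitz_continuous_map (flat_torus \<Lambda>) (flat_torus \<Lambda>') \<phi> \<and>
        homotopic_with (\<lambda>_. True) (mtopology_of (flat_torus \<Lambda>)) (mtopology_of (flat_torus \<Lambda>'))
          \<phi> (inv_into (mspace (flat_torus \<Lambda>')) f' \<circ> f)})"

text \<open>The normalization is Thurston's, the logarithm of the infimal Lipschitz constant. With a
  further factor \<open>1/2\<close> in front of the logarithm the metric would be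
  \<open>1/4\<close>, rather than \<open>1/2\<close>, times the largest \<open>log \<bar>\<lambda>\<bar>\<close>: the eigenvalues involved are squares of
  stretch factors.\<close>

definition thurston_dist_marked :: "'n::finite marking \<Rightarrow> 'n marking \<Rightarrow> real" where
  "thurston_dist_marked m m' =
     ln (INF \<phi>\<in>marking_change_maps m m'.
           lipschitz_const (flat_torus (fst m)) (flat_torus (fst m')) \<phi>)"

definition thurston_dist :: "'n::finite marking set \<Rightarrow> 'n marking set \<Rightarrow> real" where
  "thurston_dist p q = the_elem ((\<lambda>(m, m'). thurston_dist_marked m m') ` (p \<times> q))"


section \<open>Teichmueller space and positive-definite matrices\<close>

definition spd_matrices :: "(real ^ 'n ^ 'n) set" where
  "spd_matrices =
     {A. transpose A = A \<and> (\<forall>v. v \<noteq> 0 \<longrightarrow> v \<bullet> (A *v v) > 0) \<and> det A = 1}"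

text \<open>If \<open>F 0 = 0\<close>, the condition on the vectors \<open>\<zeta>\<^sub>i = g $ i\<close> reads \<open>\<zeta>\<^sub>i = F\<^sup>-\<^sup>1 e\<^sub>i\<close>; the
  term \<open>F 0\<close> admits lifts that move the origin. The \<open>\<zeta>\<^sub>i\<close> are the rows of \<open>g\<close>: an isometry
  acts on all \<open>\<zeta>\<^sub>i\<close> by a common rotation \<open>R\<close>, so that \<open>g\<close> becomes \<open>g ** transpose R\<close>, and it is for
  rows that the coset \<open>g SO(n)\<close> and the matrix \<open>g ** transpose g\<close> depend only on the point of
  Teichmueller space.\<close>

definition corresponds_to :: "'n::finite marking set \<Rightarrow> real ^ 'n ^ 'n \<Rightarrow> bool" where
  "corresponds_to p Y \<longleftrightarrow>
     (\<exists>(\<Lambda>, f)\<in>p. \<exists>F. \<exists>g :: real ^ 'n ^ 'n.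
        torus_lift \<Lambda> integer_lattice f F \<and> (\<forall>i. F (g $ i) = F 0 + axis i 1) \<and>
        Y = g ** transpose g)"

definition eigenvalues :: "real ^ 'n ^ 'n \<Rightarrow> complex set" where
  "eigenvalues A =
     {\<mu>. \<exists>v :: complex ^ 'n. v \<noteq> 0 \<and> map_matrix complex_of_real A *v v = \<mu> *s v}"

end

theory Submission
  imports Defs
begin

text \<open>A map \<open>\<phi>\<close> between marked tori that respects the markings up to homotopy lifts to a map of
  \<open>\<real>\<^sup>n\<close> which acts on the lattice as the linear map \<open>A\<close> carrying one marking basis to the other. The
  lift has the same Lipschitz constant \<open>C\<close> as \<open>\<phi>\<close>, because the projection to the torus is a local
  isometry, so \<open>\<bar>A l\<bar> \<le> C \<bar>l\<bar>\<close> for lattice vectors \<open>l\<close> and by density of their rational multiples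
  \<open>\<parallel>A\<parallel> \<le> C\<close>. The map induced by \<open>A\<close> itself has Lipschitz constant at most \<open>\<parallel>A\<parallel>\<close>, and the
  straight-line homotopy of lifts shows that it lies in the right homotopy class. Hence the distance is
  \<open>ln \<parallel>A\<parallel>\<close>, and \<open>\<parallel>A\<parallel>\<^sup>2\<close> is the largest eigenvalue of \<open>A\<^sup>T A\<close>, which is similar to
  \<open>X Y\<^sup>-\<^sup>1\<close>. The same estimate applied to an isometry and its inverse shows that the Gram matrix
  of a marking basis depends only on the point of Teichmueller space.\<close>

lemma invertible_matrix_inv:
  fixes A :: "'a::semiring_1 ^ 'n ^ 'm"
  assumes "invertible A"
  shows "A ** matrix_inv A = mat 1" and "matrix_inv A ** A = mat 1"
proof -
  have "A ** matrix_inv A = mat 1 \<and> matrix_inv A ** A = mat 1"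
    unfolding matrix_inv_def by (rule someI_ex) (use assms in \<open>simp add: invertible_def\<close>)
  then show "A ** matrix_inv A = mat 1" "matrix_inv A ** A = mat 1" by simp_all
qed

section \<open>Flat tori as quotients\<close>

lemma unimodular_lattice_add:
  assumes "unimodular_lattice \<Lambda>" "x \<in> \<Lambda>" "y \<in> \<Lambda>"
  shows "x + y \<in> \<Lambda>"
  using unimodular_lattice_diff[OF assms(1,2) unimodular_lattice_diff[OF assms(1) unimodular_lattice_0 assms(3)]]
    assms(1) by simp

lemma unimodular_lattice_scaleR:
  assumes "unimodular_lattice \<Lambda>" "x \<in> \<Lambda>"
  shows "of_int k *\<^sub>R x \<in> \<Lambda>"
proof (induction k rule: int_induct[of _ 0])
  case base
  then show ?case using unimodular_lattice_0[OF assms(1)] by simp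
next
  case (step1 i)
  then show ?case
    using unimodular_lattice_add[OF assms(1) step1(2) assms(2)] by (simp add: scaleR_left_distrib)
next
  case (step2 i)
  then show ?case
    using unimodular_lattice_diff[OF assms(1) step2(2) assms(2)] by (simp add: scaleR_left_diff_distrib)
qed

text \<open>A nonzero integer vector has norm at least 1, and the injective matrix \<open>B\<close>
  shrinks norms by at most a fixed factor. The resulting gap \<open>c\<close> makes lattice-valued
  continuous maps constant and the projection isometric at small scale.\<close>

lemma unimodular_lattice_discrete:
  fixes \<Lambda> :: "(real ^ 'n) set"
  assumes "unimodular_lattice \<Lambda>"
  obtains c where "c > 0" "\<And>l. l \<in> \<Lambda> \<Longrightarrow> l \<noteq> 0 \<Longrightarrow> c \<le> norm l"
proof -
  obtain B :: "real ^ 'n ^ 'n" where B: "\<bar>det B\<bar> = 1"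
    and \<Lambda>: "\<Lambda> = range (\<lambda>k :: int ^ 'n. B *v (\<chi> i. of_int (k $ i)))"
    using assms unfolding unimodular_lattice_def by blast
  have inj: "inj ((*v) B)"
    using B by (intro inj_matrix_vector_mult) (auto simp: invertible_det_nz)
  obtain c where c: "c > 0" "\<And>v. c * norm v \<le> norm (B *v v)"
    using linear_inj_bounded_below_pos[OF matrix_vector_mul_linear inj] by (auto simp: mult.commute)
  have "c \<le> norm l" if l: "l \<in> \<Lambda>" "l \<noteq> 0" for l
  proof -
    obtain k :: "int ^ 'n" where k: "l = B *v (\<chi> i. of_int (k $ i))"
      using l(1) unfolding \<Lambda> by blast
    have "(\<chi> i. real_of_int (k $ i)) \<noteq> 0"
      using l(2) unfolding k by auto
    then obtain i where "k $ i \<noteq> 0" by (auto simp: vec_eq_iff)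
    then have "1 \<le> \<bar>(\<chi> i. real_of_int (k $ i)) $ i\<bar>"
      by simp
    also have "\<dots> \<le> norm (\<chi> i. real_of_int (k $ i))"
      by (rule component_le_norm_cart)
    finally have "c \<le> c * norm (\<chi> i. real_of_int (k $ i))"
      using c(1) by simp
    also have "\<dots> \<le> norm l"
      unfolding k by (rule c(2))
    finally show ?thesis .
  qed
  then show thesis using c(1) that by blast
qed

lemma setdist_coset_of_le:
  assumes "unimodular_lattice \<Lambda>"
  shows "setdist (coset_of \<Lambda> x) (coset_of \<Lambda> y) \<le> norm (x - y)"
  unfolding setdist_coset_of[OF assms]
  using infdist_le[OF unimodular_lattice_0[OF assms], of "x - y"] by simp

text \<open>A nonzero lattice vector \<open>l\<close> is at distance at least
  \<open>c - norm (x - y)\<close> from \<open>x - y\<close>, so up to half the gap it comes no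
  closer than the vector 0 does.\<close>

lemma setdist_coset_of_eq:
  assumes "unimodular_lattice \<Lambda>"
    and c: "\<And>l. l \<in> \<Lambda> \<Longrightarrow> l \<noteq> 0 \<Longrightarrow> c \<le> norm l" and "norm (x - y) \<le> c / 2"
  shows "setdist (coset_of \<Lambda> x) (coset_of \<Lambda> y) = norm (x - y)"
proof (rule antisym)
  have ne: "\<Lambda> \<noteq> {}" using unimodular_lattice_0[OF assms(1)] by blast
  show "norm (x - y) \<le> setdist (coset_of \<Lambda> x) (coset_of \<Lambda> y)"
    unfolding setdist_coset_of[OF assms(1)] infdist_notempty[OF ne]
  proof (rule cINF_greatest[OF ne])
    fix l assume l: "l \<in> \<Lambda>"
    show "norm (x - y) \<le> dist (x - y) l"
    proof (cases "l = 0")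
      case False
      then have "c \<le> norm l" using c l by blast
      also have "\<dots> \<le> dist (x - y) l + norm (x - y)"
        using norm_triangle_ineq[of "l - (x - y)" "x - y"] by (simp add: dist_norm norm_minus_commute)
      finally show ?thesis using assms(3) by linarith
    qed simp
  qed
qed (rule setdist_coset_of_le[OF assms(1)])

lemma ex_representative_setdist_less:
  assumes "unimodular_lattice \<Lambda>" "setdist (coset_of \<Lambda> x) (coset_of \<Lambda> y) < e"
  obtains z where "coset_of \<Lambda> z = coset_of \<Lambda> y" "norm (x - z) < e"
proof -
  have ne: "\<Lambda> \<noteq> {}" using unimodular_lattice_0[OF assms(1)] by blast
  obtain l where l: "l \<in> \<Lambda>" "dist (x - y) l < e"
    using assms(2) cInf_lessD[of "dist (x - y) ` \<Lambda>" e] ne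
    unfolding setdist_coset_of[OF assms(1)] by (auto simp: infdist_notempty)
  have "coset_of \<Lambda> (y + l) = coset_of \<Lambda> y"
    using l(1) by (simp add: coset_of_eq_iff[OF assms(1)])
  then show thesis
    using l(2) by (intro that[of "y + l"]) (simp_all add: dist_norm algebra_simps)
qed

lemma topspace_flat_torus:
  "unimodular_lattice \<Lambda> \<Longrightarrow> topspace (mtopology_of (flat_torus \<Lambda>)) = range (coset_of \<Lambda>)"
  by (simp add: mspace_flat_torus)

section \<open>The projection as an open quotient map\<close>

lemma continuous_map_coset_of:
  assumes "unimodular_lattice \<Lambda>"
  shows "continuous_map euclidean (mtopology_of (flat_torus \<Lambda>)) (coset_of \<Lambda>)"
proof -
  have "Lipschitz_continuous_map euclidean_metric (flat_torus \<Lambda>) (coset_of \<Lambda>)"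
    unfolding Lipschitz_continuous_map_def mspace_flat_torus[OF assms] mdist_flat_torus[OF assms]
    using setdist_coset_of_le[OF assms]
    by (auto simp: dist_norm intro!: exI[of _ 1])
  from Lipschitz_continuous_imp_continuous_map[OF this] show ?thesis by simp
qed

text \<open>Every point of the torus within \<open>e\<close> of the coset of \<open>x\<close> has a
  representative within \<open>e\<close> of \<open>x\<close>, so images of Euclidean balls contain
  metric balls of the same radius.\<close>

lemma open_map_coset_of:
  assumes "unimodular_lattice \<Lambda>"
  shows "open_map euclidean (mtopology_of (flat_torus \<Lambda>)) (coset_of \<Lambda>)"
  unfolding open_map_def
proof (intro allI impI)
  fix U :: "(real ^ 'a) set" assume "openin euclidean U"
  then have U: "open U" by simp
  interpret Metric_space "range (coset_of \<Lambda>)" setdist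
    by (rule Metric_space_flat_torus[OF assms])
  have "\<exists>r>0. mball (coset_of \<Lambda> x) r \<subseteq> coset_of \<Lambda> ` U" if x: "x \<in> U" for x
  proof -
    obtain e where e: "e > 0" "ball x e \<subseteq> U" using U x by (meson open_contains_ball)
    have "mball (coset_of \<Lambda> x) e \<subseteq> coset_of \<Lambda> ` U"
    proof
      fix p assume "p \<in> mball (coset_of \<Lambda> x) e"
      then obtain y where y: "p = coset_of \<Lambda> y" "setdist (coset_of \<Lambda> x) (coset_of \<Lambda> y) < e"
        by auto
      from y(2) obtain z where z: "coset_of \<Lambda> z = coset_of \<Lambda> y" "norm (x - z) < e"
        by (rule ex_representative_setdist_less[OF assms])
      then have "z \<in> U" using e(2) by (auto simp: dist_norm)
      then show "p \<in> coset_of \<Lambda> ` U" using y(1) z(1) by (metis imageI)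
    qed
    then show ?thesis using e(1) by blast
  qed
  then show "openin (mtopology_of (flat_torus \<Lambda>)) (coset_of \<Lambda> ` U)"
    unfolding flat_torus_def mtopology_of openin_mtopology by blast
qed

lemma quotient_map_coset_of:
  assumes "unimodular_lattice \<Lambda>"
  shows "quotient_map euclidean (mtopology_of (flat_torus \<Lambda>)) (coset_of \<Lambda>)"
  by (intro continuous_open_imp_quotient_map continuous_map_coset_of open_map_coset_of assms)
    (simp add: mspace_flat_torus[OF assms])

lemma open_map_prod:
  assumes "open_map X X' f" "open_map Y Y' g"
  shows "open_map (prod_topology X Y) (prod_topology X' Y') (\<lambda>(x, y). (f x, g y))"
  unfolding open_map_def openin_prod_topology_alt
proof (intro allI impI)
  fix W x' y'
  assume W: "\<forall>x y. (x, y) \<in> W \<longrightarrow>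
      (\<exists>U V. openin X U \<and> openin Y V \<and> x \<in> U \<and> y \<in> V \<and> U \<times> V \<subseteq> W)"
    and "(x', y') \<in> (\<lambda>(x, y). (f x, g y)) ` W"
  then obtain x y where xy: "(x, y) \<in> W" "x' = f x" "y' = g y" by auto
  from W[rule_format, OF xy(1)] obtain U V
    where UV: "openin X U" "openin Y V" "x \<in> U" "y \<in> V" "U \<times> V \<subseteq> W"
    by blast
  show "\<exists>U V. openin X' U \<and> openin Y' V \<and> x' \<in> U \<and> y' \<in> V
      \<and> U \<times> V \<subseteq> (\<lambda>(x, y). (f x, g y)) ` W"
  proof (intro exI conjI)
    show "openin X' (f ` U)" "openin Y' (g ` V)"
      using UV assms by (simp_all add: open_map_def)
    show "x' \<in> f ` U" "y' \<in> g ` V" using UV xy by simp_all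
    have "f ` U \<times> g ` V = (\<lambda>(x, y). (f x, g y)) ` (U \<times> V)" by auto
    then show "f ` U \<times> g ` V \<subseteq> (\<lambda>(x, y). (f x, g y)) ` W"
      using UV(5) by (metis image_mono)
  qed
qed

text \<open>Openness passes to products. The result lets homotopies descend: a map on the cylinder
  over the torus is continuous as soon as its composite with this map is.\<close>

lemma quotient_map_coset_of_cylinder:
  assumes "unimodular_lattice \<Lambda>"
  shows "quotient_map (prod_topology (top_of_set {0..1::real}) euclidean)
      (prod_topology (top_of_set {0..1}) (mtopology_of (flat_torus \<Lambda>)))
      (\<lambda>(t, x). (t, coset_of \<Lambda> x))"
proof (rule continuous_open_imp_quotient_map)
  show "continuous_map (prod_topology (top_of_set {0..1::real}) euclidean)
      (prod_topology (top_of_set {0..1}) (mtopology_of (flat_torus \<Lambda>)))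
      (\<lambda>(t, x). (t, coset_of \<Lambda> x))"
    unfolding case_prod_beta
    by (intro continuous_map_pairedI continuous_map_fst
        continuous_map_compose[OF continuous_map_snd continuous_map_coset_of[OF assms], unfolded o_def])
  \<comment> \<open>The first factor is written as \<open>id t\<close> so that the goal has the
    shape of \<open>open_map_prod\<close>.\<close>
  have "open_map (prod_topology (top_of_set {0..1::real}) euclidean)
      (prod_topology (top_of_set {0..1}) (mtopology_of (flat_torus \<Lambda>)))
      (\<lambda>(t, x). (id t, coset_of \<Lambda> x))"
    by (intro open_map_prod open_map_coset_of[OF assms]) (simp add: open_map_def)
  then show "open_map (prod_topology (top_of_set {0..1::real}) euclidean)
      (prod_topology (top_of_set {0..1}) (mtopology_of (flat_torus \<Lambda>)))
      (\<lambda>(t, x). (t, coset_of \<Lambda> x))" by simp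
qed (auto simp: mspace_flat_torus[OF assms] image_iff)

section \<open>Lifting maps from convex sets into the torus\<close>

lemma cis_eq_iff_diff_Ints: "cis (2 * pi * a) = cis (2 * pi * b) \<longleftrightarrow> a - b \<in> \<int>"
proof -
  have "cis (2 * pi * a) = cis (2 * pi * b) \<longleftrightarrow> cis (2 * pi * (a - b)) = 1"
    by (simp add: right_diff_distrib flip: cis_divide)
  also have "\<dots> \<longleftrightarrow> (\<exists>n::int. a - b = of_int n)"
    by (simp add: cis_conv_exp exp_eq_1)
  finally show ?thesis by (auto simp: Ints_def)
qed

text \<open>Every component of \<open>B\<^sup>-\<^sup>1 x\<close> is determined modulo 1 by the coset of \<open>x\<close>, which turns a map into
  the torus into \<open>n\<close> maps into the circle; these have continuous logarithms.\<close>

lemma flat_torus_lift_exists: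
  fixes \<Lambda> :: "(real ^ 'n) set" and h :: "'a::real_normed_vector \<Rightarrow> (real ^ 'n) set"
  assumes \<Lambda>: "unimodular_lattice \<Lambda>" and "convex S"
    and h: "continuous_map (top_of_set S) (mtopology_of (flat_torus \<Lambda>)) h"
  obtains H where "continuous_on S H" "\<And>x. x \<in> S \<Longrightarrow> h x = coset_of \<Lambda> (H x)"
proof -
  obtain B :: "real ^ 'n ^ 'n" where B: "\<bar>det B\<bar> = 1"
    and \<Lambda>B: "\<Lambda> = range (\<lambda>k :: int ^ 'n. B *v (\<chi> i. of_int (k $ i)))"
    using \<Lambda> unfolding unimodular_lattice_def by blast
  define B' where "B' = matrix_inv B"
  have inv: "B ** B' = mat 1" "B' ** B = mat 1"
    using B invertible_matrix_inv[of B] unfolding B'_def by (auto simp: invertible_det_nz)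
  have BB': "B *v (B' *v x) = x" "B' *v (B *v x) = x" for x
    by (simp_all add: matrix_vector_mul_assoc inv)
  have mem: "x \<in> \<Lambda> \<longleftrightarrow> (\<forall>i. (B' *v x) $ i \<in> \<int>)" for x
  proof
    assume "\<forall>i. (B' *v x) $ i \<in> \<int>"
    then have "B' *v x = (\<chi> i. of_int ((\<chi> i. \<lfloor>(B' *v x) $ i\<rfloor>) $ i))"
      by (simp add: vec_eq_iff)
    then have "x = B *v (\<chi> i. of_int ((\<chi> i. \<lfloor>(B' *v x) $ i\<rfloor>) $ i))"
      using BB'(1)[of x] by simp
    then show "x \<in> \<Lambda>" unfolding \<Lambda>B by (rule range_eqI)
  qed (auto simp: \<Lambda>B BB')
  \<comment> \<open>The chosen representative does not matter: two of them differ by a lattice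
    vector, whose coordinates under \<open>B'\<close> are integers.\<close>
  define E where "E i p = cis (2 * pi * (B' *v (SOME x. p = coset_of \<Lambda> x)) $ i)" for i p
  have E: "E i (coset_of \<Lambda> x) = cis (2 * pi * (B' *v x) $ i)" for i x
  proof -
    have "coset_of \<Lambda> x = coset_of \<Lambda> (SOME y. coset_of \<Lambda> x = coset_of \<Lambda> y)"
      by (rule someI) (rule refl)
    then have "(SOME y. coset_of \<Lambda> x = coset_of \<Lambda> y) - x \<in> \<Lambda>"
      by (subst coset_of_eq_iff[OF \<Lambda>, symmetric]) simp
    then show ?thesis
      unfolding E_def cis_eq_iff_diff_Ints mem by (simp add: matrix_vector_mult_diff_distrib)
  qed
  have contE: "continuous_map (mtopology_of (flat_torus \<Lambda>)) euclidean (E i)" for i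
  proof -
    have "continuous_map euclidean euclidean (E i \<circ> coset_of \<Lambda>)"
      by (simp add: o_def E) (intro continuous_intros)
    then show ?thesis by (rule continuous_compose_quotient_map[OF quotient_map_coset_of[OF \<Lambda>]])
  qed
  have "\<exists>g. continuous_on S g \<and> (\<forall>x\<in>S. E i (h x) = exp (g x))" for i
  proof -
    have c: "continuous_on S (\<lambda>x. E i (h x))"
      using continuous_map_compose[OF h contE[of i]] by (simp add: o_def)
    obtain g where "continuous_on S g" "\<And>x. x \<in> S \<Longrightarrow> E i (h x) = exp (g x)"
      by (rule continuous_logarithm_on_contractible[OF c convex_imp_contractible[OF \<open>convex S\<close>]])
        (auto simp: E_def)
    then show ?thesis by blast
  qed
  then have "\<exists>g. \<forall>i. continuous_on S (g i) \<and> (\<forall>x\<in>S. E i (h x) = exp (g i x))"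
    by (intro choice allI)
  then obtain g where g: "\<And>i. continuous_on S (g i)" "\<And>i x. x \<in> S \<Longrightarrow> E i (h x) = exp (g i x)"
    by blast
  \<comment> \<open>The values of \<open>E i\<close> have modulus 1, so the logarithm
    \<open>g i\<close> is purely imaginary and its imaginary part over \<open>2 * pi\<close> is a
    real coordinate; \<open>B\<close> turns the coordinates back into a vector.\<close>
  define H where "H x = B *v (\<chi> i. Im (g i x) / (2 * pi))" for x
  have "continuous_on S H"
    unfolding H_def using g(1)
    by (intro continuous_on_compose2[OF matrix_vector_mult_linear_continuous_on[of UNIV B]]
        continuous_intros) auto
  moreover have "h x = coset_of \<Lambda> (H x)" if x: "x \<in> S" for x
  proof -
    have "h x \<in> range (coset_of \<Lambda>)"
      using continuous_map_image_subset_topspace[OF h] x by (auto simp: mspace_flat_torus[OF \<Lambda>])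
    then obtain y where y: "h x = coset_of \<Lambda> y" by blast
    have "cis (2 * pi * (B' *v y) $ i) = cis (2 * pi * (B' *v H x) $ i)" for i
    proof -
      have e: "cis (2 * pi * (B' *v y) $ i) = exp (g i x)"
        using g(2)[OF x, of i] by (simp add: y E)
      have "exp (Re (g i x)) = 1"
        using arg_cong[OF e, of norm] by (simp only: norm_exp_eq_Re norm_cis)
      then have "exp (g i x) = cis (Im (g i x))"
        using exp_eq_polar[of "g i x"] by (simp only: of_real_1 mult_1)
      then show ?thesis unfolding e by (simp add: H_def BB')
    qed
    then show ?thesis
      unfolding y coset_of_eq_iff[OF \<Lambda>] mem cis_eq_iff_diff_Ints
      by (simp add: matrix_vector_mult_diff_distrib)
  qed
  ultimately show thesis by (rule that)
qed

section \<open>Lifts and their lattice homomorphisms\<close>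

lemma torus_lift_continuous_map:
  assumes \<Lambda>: "unimodular_lattice \<Lambda>" "unimodular_lattice \<Lambda>'" and F: "torus_lift \<Lambda> \<Lambda>' f F"
  shows "continuous_map (mtopology_of (flat_torus \<Lambda>)) (mtopology_of (flat_torus \<Lambda>')) f"
proof (rule continuous_compose_quotient_map[OF quotient_map_coset_of[OF \<Lambda>(1)]])
  have "continuous_map euclidean euclidean F"
    using F by (simp add: torus_lift_def)
  from continuous_map_compose[OF this continuous_map_coset_of[OF \<Lambda>(2)]]
  show "continuous_map euclidean (mtopology_of (flat_torus \<Lambda>')) (f \<circ> coset_of \<Lambda>)"
    using F by (simp add: torus_lift_def o_def)
qed

lemma torus_lift_exists:
  assumes \<Lambda>: "unimodular_lattice \<Lambda>" "unimodular_lattice \<Lambda>'"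
    and "continuous_map (mtopology_of (flat_torus \<Lambda>)) (mtopology_of (flat_torus \<Lambda>')) f"
  obtains F where "torus_lift \<Lambda> \<Lambda>' f F"
proof -
  have "continuous_map (top_of_set UNIV) (mtopology_of (flat_torus \<Lambda>')) (f \<circ> coset_of \<Lambda>)"
    using continuous_map_compose[OF continuous_map_coset_of[OF \<Lambda>(1)] assms(3)] by simp
  then obtain F where "continuous_on UNIV F" "\<And>x. x \<in> UNIV \<Longrightarrow> (f \<circ> coset_of \<Lambda>) x = coset_of \<Lambda>' (F x)"
    by (rule flat_torus_lift_exists[OF \<Lambda>(2) convex_UNIV]) blast
  then show thesis by (intro that[of F]) (simp add: torus_lift_def)
qed

lemma torus_lift_compose:
  assumes "torus_lift \<Lambda> \<Lambda>' f F" "torus_lift \<Lambda>' \<Lambda>'' g G"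
  shows "torus_lift \<Lambda> \<Lambda>'' (g \<circ> f) (G \<circ> F)"
  using assms unfolding torus_lift_def
  by (auto intro: continuous_on_compose2[of UNIV G UNIV F])

text \<open>The distance of \<open>f z\<close> to \<open>f x\<close> takes the value 0 but no value
  strictly between 0 and the lattice gap; by connectedness it never reaches the gap.\<close>

lemma continuous_lattice_valued_constant:
  fixes f :: "'a::topological_space \<Rightarrow> real ^ 'n"
  assumes "unimodular_lattice \<Lambda>" "connected S" "continuous_on S f" "\<And>x. x \<in> S \<Longrightarrow> f x \<in> \<Lambda>"
    and "x \<in> S" "y \<in> S"
  shows "f x = f y"
proof -
  obtain c where c: "c > 0" "\<And>l. l \<in> \<Lambda> \<Longrightarrow> l \<noteq> 0 \<Longrightarrow> c \<le> norm l"
    by (rule unimodular_lattice_discrete[OF assms(1)]) blast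
  define g where "g z = norm (f z - f x)" for z
  have "connected (g ` S)"
    unfolding g_def using assms(2,3) by (intro connected_continuous_image continuous_intros)
  moreover have "0 \<in> g ` S"
    using assms(5) by (auto simp: g_def image_iff intro!: bexI[of _ x])
  moreover have "g y \<in> g ` S" using assms(6) by blast
  ultimately have ivt: "t \<in> g ` S" if "0 \<le> t" "t \<le> g y" for t
    using connectedD_interval[of "g ` S" 0 "g y" t] that by simp
  have gap: "g z = 0 \<or> c \<le> g z" if "z \<in> S" for z
    using c(2)[OF unimodular_lattice_diff[OF assms(1) assms(4)[OF that] assms(4)[OF assms(5)]]]
    by (auto simp: g_def)
  have "g y < c"
  proof (rule ccontr)
    assume "\<not> g y < c"
    then have "c / 2 \<in> g ` S" using c(1) by (intro ivt) auto
    then obtain z where "z \<in> S" "g z = c / 2" by auto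
    then show False using gap[of z] c(1) by simp
  qed
  then have "g y = 0"
    using gap[OF assms(6)] by simp
  then show ?thesis by (simp add: g_def)
qed

lemma torus_lift_diff_mem:
  assumes "unimodular_lattice \<Lambda>" "unimodular_lattice \<Lambda>'" "torus_lift \<Lambda> \<Lambda>' f F" "l \<in> \<Lambda>"
  shows "F (x + l) - F x \<in> \<Lambda>'"
proof -
  have "coset_of \<Lambda> (x + l) = coset_of \<Lambda> x"
    using assms(4) by (simp add: coset_of_eq_iff[OF assms(1)])
  then have "coset_of \<Lambda>' (F (x + l)) = coset_of \<Lambda>' (F x)"
    using assms(3) unfolding torus_lift_def by metis
  then show ?thesis by (simp add: coset_of_eq_iff[OF assms(2)])
qed

text \<open>The increment \<open>F (x + l) - F x\<close> is continuous in \<open>x\<close> and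
  lattice-valued, hence equal to its value at 0. So \<open>F l - F 0\<close>, as a function of
  \<open>l\<close>, is a homomorphism of lattices: the action of \<open>f\<close> on fundamental
  groups.\<close>

lemma torus_lift_translate:
  assumes "unimodular_lattice \<Lambda>" "unimodular_lattice \<Lambda>'" "torus_lift \<Lambda> \<Lambda>' f F" "l \<in> \<Lambda>"
  shows "F (x + l) = F x + (F l - F 0)"
proof -
  have "continuous_on UNIV F" using assms(3) by (simp add: torus_lift_def)
  moreover from this have "continuous_on UNIV (\<lambda>x. F (x + l))"
    by (rule continuous_on_compose2) (auto intro!: continuous_intros)
  ultimately have "continuous_on UNIV (\<lambda>x. F (x + l) - F x)"
    by (intro continuous_on_diff)
  then have "F (x + l) - F x = F (0 + l) - F 0"
    by (rule continuous_lattice_valued_constant[OF assms(2) connected_UNIV])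
      (simp_all add: torus_lift_diff_mem[OF assms])
  then show ?thesis by (simp add: algebra_simps)
qed

lemma torus_lift_translate_add:
  assumes "unimodular_lattice \<Lambda>" "unimodular_lattice \<Lambda>'" "torus_lift \<Lambda> \<Lambda>' f F" "k \<in> \<Lambda>" "l \<in> \<Lambda>"
  shows "F (k + l) - F 0 = (F k - F 0) + (F l - F 0)"
  using torus_lift_translate[OF assms(1-3,5), of k] by simp

text \<open>Lifting the homotopy to \<open>[0,1] \<times> \<real>\<^sup>n\<close> interpolates continuously between the translations
  induced by the two lifts, which take values in the discrete set \<open>\<Lambda>'\<close>.\<close>

lemma torus_lift_homotopic:
  assumes \<Lambda>: "unimodular_lattice \<Lambda>" "unimodular_lattice \<Lambda>'"
    and F: "torus_lift \<Lambda> \<Lambda>' f F" and G: "torus_lift \<Lambda> \<Lambda>' g G"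
    and hom: "homotopic_with (\<lambda>_. True) (mtopology_of (flat_torus \<Lambda>)) (mtopology_of (flat_torus \<Lambda>')) f g"
    and l: "l \<in> \<Lambda>"
  shows "F l - F 0 = G l - G 0"
proof -
  obtain h where h: "continuous_map (prod_topology (top_of_set {0..1::real}) (mtopology_of (flat_torus \<Lambda>)))
        (mtopology_of (flat_torus \<Lambda>')) h" and h0: "\<And>x. h (0, x) = f x" and h1: "\<And>x. h (1, x) = g x"
    using hom unfolding homotopic_with_def by blast
  have "continuous_map (top_of_set ({0..1::real} \<times> UNIV)) (mtopology_of (flat_torus \<Lambda>'))
      (h \<circ> (\<lambda>(t, x). (t, coset_of \<Lambda> x)))"
    using continuous_map_compose[OF quotient_imp_continuous_map[OF quotient_map_coset_of_cylinder[OF \<Lambda>(1)]] h]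
      prod_topology_subtopology_eu[of "{0..1::real}" "UNIV :: (real ^ 'a) set"] by simp
  then obtain H where H: "continuous_on ({0..1::real} \<times> UNIV) H"
    and hH: "\<And>x. x \<in> {0..1::real} \<times> UNIV \<Longrightarrow> (h \<circ> (\<lambda>(t, x). (t, coset_of \<Lambda> x))) x = coset_of \<Lambda>' (H x)"
    by (rule flat_torus_lift_exists[OF \<Lambda>(2) convex_Times[OF convex_closed_interval convex_UNIV]]) blast
  have slice: "continuous_on {0..1} (\<lambda>t. H (t, x))" for x
    by (rule continuous_on_compose2[OF H]) (auto intro!: continuous_intros)
  have "H (t, l) - H (t, 0) \<in> \<Lambda>'" if t: "t \<in> {0..1}" for t
  proof -
    have "coset_of \<Lambda> l = coset_of \<Lambda> 0"
      using l by (simp add: coset_of_eq_iff[OF \<Lambda>(1)])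
    then have "coset_of \<Lambda>' (H (t, l)) = coset_of \<Lambda>' (H (t, 0))"
      using hH[of "(t, l)"] hH[of "(t, 0)"] t by simp
    then show ?thesis by (simp add: coset_of_eq_iff[OF \<Lambda>(2)])
  qed
  then have e: "H (0, l) - H (0, 0) = H (1, l) - H (1, 0)"
    by (intro continuous_lattice_valued_constant[OF \<Lambda>(2), of "{0..1}" "\<lambda>t. H (t, l) - H (t, 0)"]
        continuous_intros slice) auto
  \<comment> \<open>At a fixed time, the slice of \<open>H\<close> and \<open>K\<close> lift the
    same map, so they differ by a constant lattice vector.\<close>
  have uniq: "H (t, l) - H (t, 0) = K l - K 0"
    if K: "torus_lift \<Lambda> \<Lambda>' k K" and t: "t \<in> {0..1}" and k: "\<And>x. h (t, x) = k x" for t k K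
  proof -
    have "continuous_on UNIV (\<lambda>x. H (t, x))"
      by (rule continuous_on_compose2[OF H]) (use t in \<open>auto intro!: continuous_intros\<close>)
    moreover have "continuous_on UNIV K" using K by (simp add: torus_lift_def)
    moreover have "H (t, x) - K x \<in> \<Lambda>'" for x
      using hH[of "(t, x)"] t k[of "coset_of \<Lambda> x"] K
      by (simp add: torus_lift_def flip: coset_of_eq_iff[OF \<Lambda>(2)])
    ultimately have "H (t, l) - K l = H (t, 0) - K 0"
      by (intro continuous_lattice_valued_constant[OF \<Lambda>(2), of UNIV "\<lambda>x. H (t, x) - K x"]
        continuous_intros) auto
    then show ?thesis by (simp add: algebra_simps)
  qed
  show ?thesis
    using uniq[OF F _ h0] uniq[OF G _ h1] e by simp
qed

text \<open>This is the case of the constant homotopy: the induced homomorphism depends on the map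
  and not on the lift.\<close>

lemma torus_lift_unique:
  assumes "unimodular_lattice \<Lambda>" "unimodular_lattice \<Lambda>'"
    and F: "torus_lift \<Lambda> \<Lambda>' f F" and G: "torus_lift \<Lambda> \<Lambda>' f G" and "l \<in> \<Lambda>"
  shows "F l - F 0 = G l - G 0"
  using assms torus_lift_continuous_map[OF assms(1-3)]
  by (intro torus_lift_homotopic[OF assms(1-4)]) (simp_all add: homotopic_with_refl)

text \<open>Converse of \<open>torus_lift_homotopic\<close>. Both lifts shift by the same vector
  under translation by \<open>l\<close>, hence so does every convex combination of them, and the
  straight-line homotopy descends to the torus.\<close>

lemma homotopic_of_torus_lift:
  assumes \<Lambda>: "unimodular_lattice \<Lambda>" "unimodular_lattice \<Lambda>'"
    and F: "torus_lift \<Lambda> \<Lambda>' f F" and G: "torus_lift \<Lambda> \<Lambda>' g G"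
    and FG: "\<And>l. l \<in> \<Lambda> \<Longrightarrow> F l - F 0 = G l - G 0"
  shows "homotopic_with (\<lambda>_. True) (mtopology_of (flat_torus \<Lambda>)) (mtopology_of (flat_torus \<Lambda>')) f g"
proof -
  define H where "H = (\<lambda>(t::real, x). (1 - t) *\<^sub>R F x + t *\<^sub>R G x)"
  \<comment> \<open>As the quotient has no canonical representatives, \<open>h\<close> is defined
    through a choice \<open>r\<close>; the fact \<open>h\<close> below shows that any representative
    gives the same value.\<close>
  define r where "r p = (SOME x. p = coset_of \<Lambda> x)" for p
  define h where "h = (\<lambda>(t, p). coset_of \<Lambda>' (H (t, r p)))"
  have h: "h (t, coset_of \<Lambda> x) = coset_of \<Lambda>' (H (t, x))" for t x
  proof -
    have "coset_of \<Lambda> x = coset_of \<Lambda> (r (coset_of \<Lambda> x))"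
      unfolding r_def by (rule someI) (rule refl)
    then have l: "r (coset_of \<Lambda> x) - x \<in> \<Lambda>" (is "?l \<in> \<Lambda>")
      by (subst coset_of_eq_iff[OF \<Lambda>(1), symmetric]) simp
    have e: "F (r (coset_of \<Lambda> x)) = F x + (F ?l - F 0)" "G (r (coset_of \<Lambda> x)) = G x + (F ?l - F 0)"
      using torus_lift_translate[OF \<Lambda> F l, of x] torus_lift_translate[OF \<Lambda> G l, of x] FG[OF l] by simp_all
    have "H (t, r (coset_of \<Lambda> x)) - H (t, x) = F ?l - F 0"
      unfolding H_def prod.case e by (simp add: algebra_simps)
    also have "\<dots> \<in> \<Lambda>'"
      using torus_lift_diff_mem[OF \<Lambda> F l, of 0] by simp
    finally show ?thesis
      unfolding h_def by (simp add: coset_of_eq_iff[OF \<Lambda>(2)])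
  qed
  have cF: "continuous_on UNIV F" "continuous_on UNIV G"
    using F G by (simp_all add: torus_lift_def)
  have "continuous_on ({0..1} \<times> UNIV) H"
    unfolding H_def case_prod_beta
    by (intro continuous_intros continuous_on_compose2[OF cF(1)] continuous_on_compose2[OF cF(2)]) auto
  then have "continuous_map (prod_topology (top_of_set {0..1::real}) euclidean) euclidean H"
    using prod_topology_subtopology_eu[of "{0..1::real}" "UNIV :: (real ^ 'a) set"] by simp
  from continuous_map_compose[OF this continuous_map_coset_of[OF \<Lambda>(2)]]
  have "continuous_map (prod_topology (top_of_set {0..1::real}) euclidean) (mtopology_of (flat_torus \<Lambda>'))
      (h \<circ> (\<lambda>(t, x). (t, coset_of \<Lambda> x)))"
    by (simp add: o_def h case_prod_beta)
  from continuous_compose_quotient_map[OF quotient_map_coset_of_cylinder[OF \<Lambda>(1)] this]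
  have "continuous_map (prod_topology (top_of_set {0..1}) (mtopology_of (flat_torus \<Lambda>)))
      (mtopology_of (flat_torus \<Lambda>')) h" .
  then have "homotopic_with (\<lambda>_. True) (mtopology_of (flat_torus \<Lambda>)) (mtopology_of (flat_torus \<Lambda>'))
      (\<lambda>p. h (0, p)) (\<lambda>p. h (1, p))"
    unfolding homotopic_with_def by blast
  then show ?thesis
  proof (rule homotopic_with_eq)
    fix p assume "p \<in> topspace (mtopology_of (flat_torus \<Lambda>))"
    then obtain x where p: "p = coset_of \<Lambda> x"
      unfolding topspace_flat_torus[OF \<Lambda>(1)] by blast
    show "f p = h (0, p)" "g p = h (1, p)"
      using F G unfolding p h H_def torus_lift_def by simp_all
  qed simp
qed

text \<open>Functoriality: a lift of the inverse map induces the inverse homomorphism, since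
  \<open>id\<close> lifts both composites.\<close>

lemma homeomorphic_torus_lift_bij:
  assumes \<Lambda>: "unimodular_lattice \<Lambda>" "unimodular_lattice \<Lambda>'"
    and f: "homeomorphic_map (mtopology_of (flat_torus \<Lambda>)) (mtopology_of (flat_torus \<Lambda>')) f"
    and F: "torus_lift \<Lambda> \<Lambda>' f F"
  shows "bij_betw (\<lambda>l. F l - F 0) \<Lambda> \<Lambda>'"
proof -
  obtain g where fg: "homeomorphic_maps (mtopology_of (flat_torus \<Lambda>)) (mtopology_of (flat_torus \<Lambda>')) f g"
    using f unfolding homeomorphic_map_maps by blast
  then have cg: "continuous_map (mtopology_of (flat_torus \<Lambda>')) (mtopology_of (flat_torus \<Lambda>)) g"
    and inv: "g (f (coset_of \<Lambda> x)) = coset_of \<Lambda> x" "f (g (coset_of \<Lambda>' y)) = coset_of \<Lambda>' y" for x y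
    by (simp_all add: homeomorphic_maps_def mspace_flat_torus \<Lambda>)
  obtain G where G: "torus_lift \<Lambda>' \<Lambda> g G"
    by (rule torus_lift_exists[OF \<Lambda>(2,1) cg])
  \<comment> \<open>The composite of two lifts induces the composite of the homomorphisms; the base
    point \<open>J 0\<close> cancels by \<open>torus_lift_translate\<close>.\<close>
  have comp: "K (J l) - K (J 0) = K (J l - J 0) - K 0"
    if "unimodular_lattice M" "unimodular_lattice N" "unimodular_lattice Q"
      "torus_lift M N j J" "torus_lift N Q k K" "l \<in> M" for M N Q :: "(real ^ 'a) set" and j J k K l
    using torus_lift_translate[OF that(2,3,5) torus_lift_diff_mem[OF that(1,2,4,6), of 0], of "J 0"]
    by simp
  have "torus_lift \<Lambda> \<Lambda> (g \<circ> f) id" "torus_lift \<Lambda>' \<Lambda>' (f \<circ> g) id"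
    using inv by (simp_all add: torus_lift_def)
  note id = this
  show ?thesis
  proof (rule bij_betwI[where g = "\<lambda>l. G l - G 0"])
    show "(\<lambda>l. F l - F 0) \<in> \<Lambda> \<rightarrow> \<Lambda>'"
      using torus_lift_diff_mem[OF \<Lambda> F, of _ 0] by simp
    show "(\<lambda>l. G l - G 0) \<in> \<Lambda>' \<rightarrow> \<Lambda>"
      using torus_lift_diff_mem[OF \<Lambda>(2,1) G, of _ 0] by simp
    show "G (F l - F 0) - G 0 = l" if l: "l \<in> \<Lambda>" for l
      using torus_lift_unique[OF \<Lambda>(1,1) torus_lift_compose[OF F G] id(1) l]
        comp[OF \<Lambda> \<Lambda>(1) F G l] by simp
    show "F (G l - G 0) - F 0 = l" if l: "l \<in> \<Lambda>'" for l
      using torus_lift_unique[OF \<Lambda>(2,2) torus_lift_compose[OF G F] id(2) l]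
        comp[OF \<Lambda>(2,1,2) G F l] by simp
  qed
qed

text \<open>The projection never increases distances on the source side and preserves distances up
  to \<open>c / 2\<close> on the target side, so \<open>F\<close> satisfies the bound on short
  steps. The bounds add up along a subdivided segment.\<close>

lemma torus_lift_lipschitz:
  assumes \<Lambda>: "unimodular_lattice \<Lambda>" "unimodular_lattice \<Lambda>'"
    and F: "torus_lift \<Lambda> \<Lambda>' f F"
    and lip: "\<And>x y. setdist (f (coset_of \<Lambda> x)) (f (coset_of \<Lambda> y))
        \<le> C * setdist (coset_of \<Lambda> x) (coset_of \<Lambda> y)"
    and C: "C \<ge> 0"
  shows "norm (F x - F y) \<le> C * norm (x - y)"
proof -
  obtain c where c: "c > 0" "\<And>l. l \<in> \<Lambda>' \<Longrightarrow> l \<noteq> 0 \<Longrightarrow> c \<le> norm l"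
    by (rule unimodular_lattice_discrete[OF \<Lambda>(2)]) blast
  have "continuous_on UNIV F" using F by (simp add: torus_lift_def)
  then have "uniformly_continuous_on (closed_segment y x) F"
    by (intro compact_uniformly_continuous compact_segment) (auto intro: continuous_on_subset)
  moreover have "c / 2 > 0" using c by simp
  ultimately obtain d where d: "d > 0"
    "\<And>u v. u \<in> closed_segment y x \<Longrightarrow> v \<in> closed_segment y x \<Longrightarrow> dist v u < d \<Longrightarrow> dist (F v) (F u) < c / 2"
    unfolding uniformly_continuous_on_def by metis
  have short: "norm (F u - F v) \<le> C * norm (u - v)"
    if uv: "u \<in> closed_segment y x" "v \<in> closed_segment y x" "dist u v < d" for u v
  proof -
    have "norm (F u - F v) = setdist (f (coset_of \<Lambda> u)) (f (coset_of \<Lambda> v))"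
      using d(2)[OF uv(2,1,3)] F setdist_coset_of_eq[OF \<Lambda>(2) c(2), of "F u" "F v"]
      by (simp add: torus_lift_def dist_norm)
    also have "\<dots> \<le> C * setdist (coset_of \<Lambda> u) (coset_of \<Lambda> v)" by (rule lip)
    also have "\<dots> \<le> C * norm (u - v)"
      by (rule mult_left_mono[OF setdist_coset_of_le[OF \<Lambda>(1)] C])
    finally show ?thesis .
  qed
  \<comment> \<open>Cutting the segment into \<open>N\<close> equal pieces makes each shorter than
    \<open>d\<close>, the scale at which \<open>F\<close> moves points by less than
    \<open>c / 2\<close>.\<close>
  obtain N :: nat where N: "norm (x - y) / d < real N" using reals_Archimedean2 by blast
  have "0 \<le> norm (x - y) / d" using d(1) by simp
  then have N0: "N > 0" using N by (cases N) auto
  define u where "u i = y + (real i / real N) *\<^sub>R (x - y)" for i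
  have u: "u i \<in> closed_segment y x" if "i \<le> N" for i
  proof -
    have "u i = (1 - real i / real N) *\<^sub>R y + (real i / real N) *\<^sub>R x"
      by (simp add: u_def algebra_simps)
    then show ?thesis using that N0 unfolding closed_segment_def
      by (auto intro!: exI[of _ "real i / real N"])
  qed
  have diff: "u (Suc i) - u i = (1 / real N) *\<^sub>R (x - y)" for i
    by (simp add: u_def add_divide_distrib scaleR_left_distrib)
  have step: "norm (F (u (Suc i)) - F (u i)) \<le> C * (norm (x - y) / N)" if "i < N" for i
  proof -
    have "dist (u (Suc i)) (u i) < d"
      unfolding dist_norm diff norm_scaleR using N N0 d(1) by (simp add: field_simps)
    then have "norm (F (u (Suc i)) - F (u i)) \<le> C * norm (u (Suc i) - u i)"
      using that by (intro short u) auto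
    then show ?thesis unfolding diff by simp
  qed
  have "F x - F y = (\<Sum>i<N. F (u (Suc i)) - F (u i))"
    using sum_lessThan_telescope[of "\<lambda>i. F (u i)" N] N0 by (simp add: u_def)
  also have "norm \<dots> \<le> (\<Sum>i<N. C * (norm (x - y) / N))"
    by (rule order_trans[OF norm_sum sum_mono[OF step]]) simp
  also have "\<dots> = C * norm (x - y)"
    using N0 by simp
  finally show ?thesis .
qed

section \<open>Marked tori\<close>

text \<open>Marking vectors are the rows of \<open>g\<close>, so \<open>transpose g\<close> takes
  integer coordinates to lattice vectors; lattices are parametrised in this way below.\<close>

lemma transpose_mult_eq_sum:
  fixes g :: "real ^ 'n ^ 'm"
  shows "transpose g *v k = (\<Sum>i\<in>UNIV. k $ i *\<^sub>R g $ i)"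
  by (simp add: matrix_mult_sum scalar_mult_eq_scaleR column_transpose row_def)

text \<open>Additivity is assumed on the lattice only, so each partial sum must be known to lie
  there; hence one induction proves both conclusions.\<close>

lemma unimodular_lattice_hom:
  fixes f :: "real ^ 'n \<Rightarrow> real ^ 'm"
  assumes \<Lambda>: "unimodular_lattice \<Lambda>" and add: "\<And>x y. x \<in> \<Lambda> \<Longrightarrow> y \<in> \<Lambda> \<Longrightarrow> f (x + y) = f x + f y"
    and g: "\<And>i. i \<in> I \<Longrightarrow> g i \<in> \<Lambda>" "\<And>i. i \<in> I \<Longrightarrow> k i \<in> \<int>" and "finite I"
  shows "(\<Sum>i\<in>I. k i *\<^sub>R g i) \<in> \<Lambda>" "f (\<Sum>i\<in>I. k i *\<^sub>R g i) = (\<Sum>i\<in>I. k i *\<^sub>R f (g i))"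
proof -
  have zero: "f 0 = 0"
    using add[of 0 0] unimodular_lattice_0[OF \<Lambda>] by simp
  have nat: "f (real n *\<^sub>R x) = real n *\<^sub>R f x" if x: "x \<in> \<Lambda>" for x n
  proof (induction n)
    case (Suc n)
    have "f (x + real n *\<^sub>R x) = f x + f (real n *\<^sub>R x)"
      using unimodular_lattice_scaleR[OF \<Lambda> x, of "int n"] by (intro add x) simp
    then show ?case by (simp add: Suc scaleR_left_distrib)
  qed (simp add: zero)
  have int: "f (a *\<^sub>R x) = a *\<^sub>R f x" if x: "x \<in> \<Lambda>" and a: "a \<in> \<int>" for x a
  proof -
    obtain n where n: "a = real n \<or> a = - real n"
      using a by (metis Ints_cases int_cases2 of_int_minus of_int_of_nat_eq)
    have "f (- (real n *\<^sub>R x)) + f (real n *\<^sub>R x) = 0"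
      using unimodular_lattice_scaleR[OF \<Lambda> x, of "int n"] unimodular_lattice_scaleR[OF \<Lambda> x, of "- int n"]
      by (subst add[symmetric]) (simp_all add: zero)
    then have "f (- (real n *\<^sub>R x)) = - (real n *\<^sub>R f x)"
      by (simp add: nat[OF x] eq_neg_iff_add_eq_0)
    then show ?thesis using n nat[OF x] by auto
  qed
  have mem: "k i *\<^sub>R g i \<in> \<Lambda>" if "i \<in> I" for i
    using unimodular_lattice_scaleR[OF \<Lambda> g(1)[OF that]] g(2)[OF that] by (auto elim!: Ints_cases)
  have "(\<Sum>i\<in>I. k i *\<^sub>R g i) \<in> \<Lambda> \<and> f (\<Sum>i\<in>I. k i *\<^sub>R g i) = (\<Sum>i\<in>I. k i *\<^sub>R f (g i))"
    using \<open>finite I\<close> g mem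
  proof (induction I)
    case (insert i I)
    then have IH: "(\<Sum>i\<in>I. k i *\<^sub>R g i) \<in> \<Lambda>" "f (\<Sum>i\<in>I. k i *\<^sub>R g i) = (\<Sum>i\<in>I. k i *\<^sub>R f (g i))"
      by simp_all
    have i: "k i *\<^sub>R g i \<in> \<Lambda>" "g i \<in> \<Lambda>" "k i \<in> \<int>" using insert.prems by simp_all
    show ?case
      using insert.hyps add[OF i(1) IH(1)] int[OF i(2,3)] unimodular_lattice_add[OF \<Lambda> i(1) IH(1)] IH(2)
      by simp
  qed (simp_all add: zero unimodular_lattice_0[OF \<Lambda>])
  then show "(\<Sum>i\<in>I. k i *\<^sub>R g i) \<in> \<Lambda>" "f (\<Sum>i\<in>I. k i *\<^sub>R g i) = (\<Sum>i\<in>I. k i *\<^sub>R f (g i))"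
    by simp_all
qed

lemma norm_mult_le_of_integer:
  fixes M N :: "real ^ 'n ^ 'm"
  assumes "\<And>k. k \<in> integer_lattice \<Longrightarrow> norm (M *v k) \<le> C * norm (N *v k)"
  shows "norm (M *v v) \<le> C * norm (N *v v)"
proof -
  \<comment> \<open>Rounding \<open>m v\<close> down to an integer vector and dividing by
    \<open>m\<close> approximates \<open>v\<close>.\<close>
  define k where "k m = (\<chi> i. real_of_int \<lfloor>real m * v $ i\<rfloor>)" for m :: nat
  define u where "u m = (1 / real m) *\<^sub>R k m" for m
  have "(\<lambda>m. real_of_int \<lfloor>real m * x\<rfloor> / real m) \<longlonglongrightarrow> x" for x :: real
  proof (rule LIM_zero_cancel, rule Lim_null_comparison)
    show "\<forall>\<^sub>F m in sequentially. norm (real_of_int \<lfloor>real m * x\<rfloor> / real m - x) \<le> 1 / real m"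
      using eventually_gt_at_top[of 0]
    proof eventually_elim
      fix m :: nat assume m: "m > 0"
      have "\<bar>real_of_int \<lfloor>real m * x\<rfloor> - real m * x\<bar> \<le> 1" by linarith
      then have "\<bar>(real_of_int \<lfloor>real m * x\<rfloor> - real m * x) / real m\<bar> \<le> 1 / real m"
        unfolding abs_divide using m by (simp add: divide_right_mono)
      then show "norm (real_of_int \<lfloor>real m * x\<rfloor> / real m - x) \<le> 1 / real m"
        using m by (simp add: diff_divide_distrib)
    qed
  qed (rule lim_1_over_n)
  then have u: "u \<longlonglongrightarrow> v"
    unfolding u_def k_def by (intro vec_tendstoI) simp
  \<comment> \<open>The inequality is homogeneous, so it scales by \<open>1 / m\<close>; for
    \<open>m = 0\<close> this factor is 0 by convention and both sides vanish.\<close>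
  have "norm (M *v u m) \<le> C * norm (N *v u m)" for m
  proof -
    have "k m \<in> integer_lattice" by (simp add: k_def integer_lattice_def)
    from mult_left_mono[OF assms[OF this], of "1 / real m"] show ?thesis
      by (simp add: u_def matrix_vector_mult_scaleR mult_ac)
  qed
  moreover have lim: "(\<lambda>m. norm (A *v u m)) \<longlonglongrightarrow> norm (A *v v)" for A :: "real ^ 'n ^ 'm"
    by (intro tendsto_norm isCont_tendsto_compose[OF matrix_vector_mult_linear_continuous_at u])
  ultimately show ?thesis
    by (intro LIMSEQ_le[OF lim tendsto_mult[OF tendsto_const lim]]) auto
qed

text \<open>The condition on \<open>g\<close> inside \<open>corresponds_to\<close>, at a single
  marked torus and without the Gram matrix, because the basis itself is used below.\<close>

definition marking_basis ::
  "(real ^ 'n) set \<Rightarrow> ((real ^ 'n) set \<Rightarrow> (real ^ 'n) set) \<Rightarrow> real ^ 'n ^ 'n \<Rightarrow> bool" where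
  "marking_basis \<Lambda> f g \<longleftrightarrow>
     (\<exists>F. torus_lift \<Lambda> integer_lattice f F \<and> (\<forall>i. F (g $ i) = F 0 + axis i 1))"

lemma marked_toriD:
  assumes "(\<Lambda>, f) \<in> marked_tori"
  shows "unimodular_lattice \<Lambda>"
    and "homeomorphic_map (mtopology_of (flat_torus \<Lambda>)) (mtopology_of standard_torus) f"
    and "\<exists>F. torus_lift \<Lambda> integer_lattice f F"
  using assms by (auto simp: marked_tori_def orientation_preserving_def)

lemma axis_mem_integer_lattice: "axis i 1 \<in> integer_lattice"
  by (simp add: integer_lattice_def axis_def)

text \<open>The values of \<open>F\<close> at \<open>g $ i\<close> and at 0 differ by an integer
  vector, so \<open>f\<close> identifies the two cosets, and \<open>f\<close> is injective.\<close>

lemma marking_basis_mem: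
  assumes m: "(\<Lambda>, f) \<in> marked_tori" and g: "marking_basis \<Lambda> f g"
  shows "g $ i \<in> \<Lambda>"
proof -
  obtain F where F: "torus_lift \<Lambda> integer_lattice f F" "F (g $ i) = F 0 + axis i 1"
    using g unfolding marking_basis_def by blast
  have "coset_of integer_lattice (F (g $ i)) = coset_of integer_lattice (F 0)"
    by (simp add: coset_of_eq_iff[OF unimodular_lattice_integer_lattice] F(2) axis_mem_integer_lattice)
  then have "f (coset_of \<Lambda> (g $ i)) = f (coset_of \<Lambda> 0)"
    using F(1) by (simp add: torus_lift_def)
  moreover have "inj_on f (range (coset_of \<Lambda>))"
    using marked_toriD(2)[OF m] mspace_flat_torus[OF marked_toriD(1)[OF m]]
    by (simp add: homeomorphic_map_def)
  ultimately have "coset_of \<Lambda> (g $ i) = coset_of \<Lambda> 0"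
    by (simp add: inj_on_eq_iff)
  then show ?thesis by (simp add: coset_of_eq_iff[OF marked_toriD(1)[OF m]])
qed

lemma marking_basis_lift:
  assumes m: "(\<Lambda>, f) \<in> marked_tori" and g: "marking_basis \<Lambda> f g"
    and F: "torus_lift \<Lambda> integer_lattice f F"
  shows "F (g $ i) - F 0 = axis i 1"
proof -
  obtain F' where F': "torus_lift \<Lambda> integer_lattice f F'" "F' (g $ i) = F' 0 + axis i 1"
    using g unfolding marking_basis_def by blast
  show ?thesis
    using torus_lift_unique[OF marked_toriD(1)[OF m] unimodular_lattice_integer_lattice F F'(1)
        marking_basis_mem[OF m g]] F'(2) by simp
qed

lemma marked_torus_lift_bij:
  assumes m: "(\<Lambda>, f) \<in> marked_tori" and F: "torus_lift \<Lambda> integer_lattice f F"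
  shows "bij_betw (\<lambda>l. F l - F 0) \<Lambda> integer_lattice"
  by (rule homeomorphic_torus_lift_bij[OF marked_toriD(1)[OF m] unimodular_lattice_integer_lattice
      marked_toriD(2)[OF m] F])

text \<open>The induced homomorphism is onto the integer lattice, so the standard basis vectors have
  preimages.\<close>

lemma marking_basis_exists:
  assumes m: "(\<Lambda>, f) \<in> marked_tori"
  obtains g where "marking_basis \<Lambda> f g"
proof -
  obtain F where F: "torus_lift \<Lambda> integer_lattice f F" using marked_toriD(3)[OF m] by blast
  have "\<exists>l. F l = F 0 + axis i 1" for i
  proof -
    have "axis i 1 \<in> (\<lambda>l. F l - F 0) ` \<Lambda>"
      using marked_torus_lift_bij[OF m F] axis_mem_integer_lattice by (simp add: bij_betw_def)
    then show ?thesis by (auto simp: algebra_simps)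
  qed
  then obtain g where g: "\<And>i. F (g i) = F 0 + axis i 1" by metis
  then show thesis
    using F by (intro that[of "\<chi> i. g i"]) (auto simp: marking_basis_def)
qed

lemma torus_lift_transpose_mult:
  assumes \<Lambda>: "unimodular_lattice \<Lambda>" "unimodular_lattice \<Lambda>'" and F: "torus_lift \<Lambda> \<Lambda>' f F"
    and g: "\<And>i. g $ i \<in> \<Lambda>" "\<And>i. F (g $ i) - F 0 = g' $ i" and k: "k \<in> integer_lattice"
  shows "transpose g *v k \<in> \<Lambda>" "F (transpose g *v k) - F 0 = transpose g' *v k"
  using unimodular_lattice_hom[OF \<Lambda>(1), of "\<lambda>l. F l - F 0" UNIV "\<lambda>i. g $ i" "\<lambda>i. k $ i"]
    torus_lift_translate_add[OF \<Lambda> F] g k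
  by (simp_all add: transpose_mult_eq_sum integer_lattice_def del: transpose_matrix_vector)

text \<open>The marking vectors generate the lattice because the induced isomorphism carries them to
  the standard basis.\<close>

lemma marking_basis_lattice:
  fixes g :: "real ^ 'n ^ 'n"
  assumes m: "(\<Lambda>, f) \<in> marked_tori" and g: "marking_basis \<Lambda> f g"
  shows "\<Lambda> = (*v) (transpose g) ` integer_lattice"
proof -
  obtain F where F: "torus_lift \<Lambda> integer_lattice f F" using marked_toriD(3)[OF m] by blast
  \<comment> \<open>The standard basis is written as the rows of \<open>mat 1\<close> to fit
    \<open>torus_lift_transpose_mult\<close>.\<close>
  have g1: "F (g $ i) - F 0 = mat 1 $ i" for i
    using marking_basis_lift[OF m g F, of i] by (simp add: vec_eq_iff mat_def axis_def)
  note mult = torus_lift_transpose_mult[OF marked_toriD(1)[OF m] unimodular_lattice_integer_lattice F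
      marking_basis_mem[OF m g] g1]
  have "l \<in> (*v) (transpose g) ` integer_lattice" if l: "l \<in> \<Lambda>" for l
  proof -
    define k where "k = F l - F 0"
    have k: "k \<in> integer_lattice"
      using marked_torus_lift_bij[OF m F] l unfolding k_def bij_betw_def by blast
    have "F (transpose g *v k) - F 0 = F l - F 0"
      using mult(2)[OF k] by (simp add: k_def)
    then have "transpose g *v k = l"
      using marked_torus_lift_bij[OF m F] mult(1)[OF k] l unfolding bij_betw_def inj_on_def by blast
    then show ?thesis using k by blast
  qed
  then show ?thesis using mult(1) by blast
qed

text \<open>The homotopy says that the homomorphism of \<open>\<phi>\<close> followed by that of
  \<open>f'\<close> is that of \<open>f\<close>. Both markings send their basis vectors to the
  standard ones, and that of \<open>f'\<close> is injective, so basis vectors correspond.\<close>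

lemma marking_change_lift:
  assumes m: "(\<Lambda>, f) \<in> marked_tori" and g: "marking_basis \<Lambda> f g"
    and m': "(\<Lambda>', f') \<in> marked_tori" and g': "marking_basis \<Lambda>' f' g'"
    and \<Phi>: "torus_lift \<Lambda> \<Lambda>' \<phi> \<Phi>"
    and hom: "homotopic_with (\<lambda>_. True) (mtopology_of (flat_torus \<Lambda>)) (mtopology_of standard_torus) (f' \<circ> \<phi>) f"
    and k: "k \<in> integer_lattice"
  shows "\<Phi> (transpose g *v k) - \<Phi> 0 = transpose g' *v k"
proof -
  note \<Lambda> = marked_toriD(1)[OF m] and \<Lambda>' = marked_toriD(1)[OF m']
  note int = unimodular_lattice_integer_lattice
  obtain F F' where F: "torus_lift \<Lambda> integer_lattice f F" and F': "torus_lift \<Lambda>' integer_lattice f' F'"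
    using marked_toriD(3)[OF m] marked_toriD(3)[OF m'] by blast
  have "\<Phi> (g $ i) - \<Phi> 0 = g' $ i" for i
  proof -
    have mem: "\<Phi> (g $ i) - \<Phi> 0 \<in> \<Lambda>'"
      using torus_lift_diff_mem[OF \<Lambda> \<Lambda>' \<Phi> marking_basis_mem[OF m g, of i], of 0] by simp
    have "F' (\<Phi> (g $ i) - \<Phi> 0) - F' 0 = F' (\<Phi> (g $ i)) - F' (\<Phi> 0)"
      using torus_lift_translate[OF \<Lambda>' int F' mem, of "\<Phi> 0"] by simp
    also have "\<dots> = F (g $ i) - F 0"
      using torus_lift_homotopic[OF \<Lambda> int torus_lift_compose[OF \<Phi> F'] F hom marking_basis_mem[OF m g, of i]]
      by simp
    also have "\<dots> = F' (g' $ i) - F' 0"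
      using marking_basis_lift[OF m g F] marking_basis_lift[OF m' g' F'] by simp
    finally show ?thesis
      using marked_torus_lift_bij[OF m' F'] mem marking_basis_mem[OF m' g', of i]
      unfolding bij_betw_def inj_on_def by blast
  qed
  then show ?thesis
    by (rule torus_lift_transpose_mult(2)[OF \<Lambda> \<Lambda>' \<Phi> marking_basis_mem[OF m g] _ k])
qed

text \<open>The lift inherits the Lipschitz bound and is known on lattice vectors, where the bound
  is evaluated. Any continuous \<open>\<phi>\<close> is allowed, so that the lemma serves both the
  maps in the infimum and the isometries between representatives.\<close>

lemma marking_change_norm_le:
  assumes m: "(\<Lambda>, f) \<in> marked_tori" and g: "marking_basis \<Lambda> f g"
    and m': "(\<Lambda>', f') \<in> marked_tori" and g': "marking_basis \<Lambda>' f' g'"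
    and \<phi>: "continuous_map (mtopology_of (flat_torus \<Lambda>)) (mtopology_of (flat_torus \<Lambda>')) \<phi>"
    and hom: "homotopic_with (\<lambda>_. True) (mtopology_of (flat_torus \<Lambda>)) (mtopology_of standard_torus) (f' \<circ> \<phi>) f"
    and lip: "\<And>x y. setdist (\<phi> (coset_of \<Lambda> x)) (\<phi> (coset_of \<Lambda> y))
        \<le> C * setdist (coset_of \<Lambda> x) (coset_of \<Lambda> y)"
    and C: "C \<ge> 0"
  shows "norm (transpose g' *v v) \<le> C * norm (transpose g *v v)"
proof (rule norm_mult_le_of_integer)
  fix k :: "real ^ 'a" assume k: "k \<in> integer_lattice"
  note \<Lambda> = marked_toriD(1)[OF m] and \<Lambda>' = marked_toriD(1)[OF m']
  obtain \<Phi> where \<Phi>: "torus_lift \<Lambda> \<Lambda>' \<phi> \<Phi>"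
    by (rule torus_lift_exists[OF \<Lambda> \<Lambda>' \<phi>])
  show "norm (transpose g' *v k) \<le> C * norm (transpose g *v k)"
    using torus_lift_lipschitz[OF \<Lambda> \<Lambda>' \<Phi> lip C, of "transpose g *v k" 0]
    unfolding marking_change_lift[OF m g m' g' \<Phi> hom k] by simp
qed

text \<open>Polarisation: the entries of the Gram matrix are inner products of images of standard
  basis vectors, and norms determine inner products.\<close>

lemma gram_eq_of_norm_eq:
  fixes g g' :: "real ^ 'n ^ 'n"
  assumes "\<And>v. norm (transpose g *v v) = norm (transpose g' *v v)"
  shows "g ** transpose g = g' ** transpose g'"
proof -
  have polar: "(transpose a *v u) \<bullet> (transpose a *v v) =
      ((norm (transpose a *v (u + v)))\<^sup>2 - (norm (transpose a *v (u - v)))\<^sup>2) / 4"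
    for a :: "real ^ 'n ^ 'n" and u v
    by (simp add: matrix_vector_right_distrib matrix_vector_mult_diff_distrib power2_norm_eq_inner
        inner_simps inner_commute)
  have gram: "(a ** transpose a) $ i $ j = (transpose a *v axis i 1) \<bullet> (transpose a *v axis j 1)"
    for a :: "real ^ 'n ^ 'n" and i j
    by (simp add: matrix_vector_mul_component matrix_matrix_mult_def transpose_def inner_vec_def
        matrix_vector_mult_def axis_def if_distrib cong: if_cong)
  show ?thesis
    unfolding vec_eq_iff gram polar assms by simp
qed

lemma marking_rel_gram:
  assumes rel: "((\<Lambda>, f), (\<Lambda>', f')) \<in> marking_rel"
    and g: "marking_basis \<Lambda> f g" and g': "marking_basis \<Lambda>' f' g'"
  shows "g ** transpose g = g' ** transpose g'"
proof -
  have m: "(\<Lambda>, f) \<in> marked_tori" and m': "(\<Lambda>', f') \<in> marked_tori"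
    using rel by (simp_all add: marking_rel_def)
  note \<Lambda> = marked_toriD(1)[OF m] and \<Lambda>' = marked_toriD(1)[OF m']
  let ?S = "flat_torus \<Lambda>" and ?S' = "flat_torus \<Lambda>'"
  obtain h where h: "isometry_between ?S ?S' h"
    and hom: "homotopic_with (\<lambda>_. True) (mtopology_of ?S) (mtopology_of standard_torus) (f' \<circ> h) f"
    using rel by (auto simp: marking_rel_def)
  have bij: "bij_betw h (mspace ?S) (mspace ?S')"
    and iso: "\<And>x y. x \<in> mspace ?S \<Longrightarrow> y \<in> mspace ?S \<Longrightarrow> mdist ?S' (h x) (h y) = mdist ?S x y"
    using h by (simp_all add: isometry_between_def)
  define h' where "h' = inv_into (mspace ?S) h"
  have bij': "bij_betw h' (mspace ?S') (mspace ?S)"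
    unfolding h'_def by (rule bij_betw_inv_into[OF bij])
  have hh': "h (h' y) = y" if "y \<in> mspace ?S'" for y
    using that bij unfolding h'_def by (simp add: bij_betw_inv_into_right)
  have mem': "h' y \<in> mspace ?S" if "y \<in> mspace ?S'" for y
    using that bij' by (simp add: bij_betw_apply)
  have iso': "mdist ?S (h' x) (h' y) = mdist ?S' x y" if "x \<in> mspace ?S'" "y \<in> mspace ?S'" for x y
    using iso[OF mem' mem', OF that] hh' that by simp
  have "Lipschitz_continuous_map ?S ?S' h"
    using bij iso unfolding Lipschitz_continuous_map_def
    by (intro conjI exI[of _ 1]) (auto simp: bij_betw_def)
  then have ch: "continuous_map (mtopology_of ?S) (mtopology_of ?S') h"
    by (rule Lipschitz_continuous_imp_continuous_map)
  have "Lipschitz_continuous_map ?S' ?S h'"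
    using bij' iso' unfolding Lipschitz_continuous_map_def
    by (intro conjI exI[of _ 1]) (auto simp: bij_betw_def)
  then have ch': "continuous_map (mtopology_of ?S') (mtopology_of ?S) h'"
    by (rule Lipschitz_continuous_imp_continuous_map)
  \<comment> \<open>Precomposition with the inverse isometry turns the homotopy into the one
    required for the opposite inequality.\<close>
  have "homotopic_with (\<lambda>_. True) (mtopology_of ?S') (mtopology_of standard_torus) (f \<circ> h') (f' \<circ> h \<circ> h')"
    by (rule homotopic_with_compose_continuous_map_right[OF homotopic_with_symD[OF hom] ch']) simp
  then have hom': "homotopic_with (\<lambda>_. True) (mtopology_of ?S') (mtopology_of standard_torus) (f \<circ> h') f'"
    by (rule homotopic_with_eq) (simp_all add: hh')
  have "norm (transpose g' *v v) \<le> 1 * norm (transpose g *v v)" for v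
    using iso by (intro marking_change_norm_le[OF m g m' g' ch hom])
      (simp_all add: mspace_flat_torus mdist_flat_torus \<Lambda> \<Lambda>')
  moreover have "norm (transpose g *v v) \<le> 1 * norm (transpose g' *v v)" for v
    using iso' by (intro marking_change_norm_le[OF m' g' m g ch' hom'])
      (simp_all add: mspace_flat_torus mdist_flat_torus \<Lambda> \<Lambda>')
  ultimately show ?thesis
    by (intro gram_eq_of_norm_eq antisym) simp_all
qed

section \<open>Linear maps between tori and Lipschitz constants\<close>

lemma torus_lift_image:
  fixes A :: "real ^ 'n ^ 'n"
  assumes "(*v) A ` \<Lambda> = \<Lambda>'"
  shows "torus_lift \<Lambda> \<Lambda>' ((`) ((*v) A)) ((*v) A)"
  unfolding torus_lift_def coset_of_def assms[symmetric]
  by (auto simp: image_image matrix_vector_right_distrib matrix_vector_mult_linear_continuous_on)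

text \<open>The lattice is closed, so some \<open>l\<close> in it is nearest to
  \<open>x - y\<close>; its image \<open>A *v l\<close> competes in the distance on the
  target.\<close>

lemma setdist_image_coset_of_le:
  fixes A :: "real ^ 'n ^ 'n"
  assumes \<Lambda>: "unimodular_lattice \<Lambda>" "unimodular_lattice \<Lambda>'" and A: "(*v) A ` \<Lambda> = \<Lambda>'"
  shows "setdist (coset_of \<Lambda>' (A *v x)) (coset_of \<Lambda>' (A *v y))
      \<le> onorm ((*v) A) * setdist (coset_of \<Lambda> x) (coset_of \<Lambda> y)"
proof -
  have "\<Lambda> \<noteq> {}" using unimodular_lattice_0[OF \<Lambda>(1)] by blast
  then obtain l where l: "l \<in> \<Lambda>" "infdist (x - y) \<Lambda> = dist (x - y) l"
    using infdist_attains_inf[OF unimodular_lattice_closed[OF \<Lambda>(1)]] by blast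
  have "infdist (A *v x - A *v y) \<Lambda>' \<le> dist (A *v x - A *v y) (A *v l)"
    by (rule infdist_le) (use A l in blast)
  also have "\<dots> = norm (A *v (x - y - l))"
    by (simp add: dist_norm matrix_vector_mult_diff_distrib)
  also have "\<dots> \<le> onorm ((*v) A) * norm (x - y - l)"
    by (rule onorm) simp
  finally show ?thesis
    unfolding setdist_coset_of[OF \<Lambda>(1)] setdist_coset_of[OF \<Lambda>(2)] l(2) by (simp add: dist_norm)
qed

lemma flat_torus_nontrivial:
  fixes \<Lambda> :: "(real ^ 'n) set"
  assumes "unimodular_lattice \<Lambda>"
  obtains x where "coset_of \<Lambda> x \<noteq> coset_of \<Lambda> 0"
proof -
  obtain c where c: "c > 0" "\<And>l. l \<in> \<Lambda> \<Longrightarrow> l \<noteq> 0 \<Longrightarrow> c \<le> norm l"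
    by (rule unimodular_lattice_discrete[OF assms]) blast
  obtain x :: "real ^ 'n" where x: "norm x = c / 2"
    using c(1) vector_choose_size[of "c / 2"] by auto
  then have "x \<noteq> 0" "\<not> c \<le> norm x" using c(1) by auto
  then have "x \<notin> \<Lambda>" using c(2) by blast
  then show thesis
    by (intro that[of x]) (simp add: coset_of_eq_iff[OF assms])
qed

text \<open>The difference quotients are bounded because the map is Lipschitz, and there is at least
  one because the torus has two points. Their \<open>Sup\<close> is therefore a true least upper
  bound.\<close>

lemma lipschitz_const_flat_torus:
  assumes \<Lambda>: "unimodular_lattice \<Lambda>" "unimodular_lattice \<Lambda>'"
    and lip: "Lipschitz_continuous_map (flat_torus \<Lambda>) (flat_torus \<Lambda>') \<phi>"
  shows "setdist (\<phi> (coset_of \<Lambda> x)) (\<phi> (coset_of \<Lambda> y))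
      \<le> lipschitz_const (flat_torus \<Lambda>) (flat_torus \<Lambda>') \<phi> * setdist (coset_of \<Lambda> x) (coset_of \<Lambda> y)"
    and "lipschitz_const (flat_torus \<Lambda>) (flat_torus \<Lambda>') \<phi> \<ge> 0"
    and "(\<And>x y. setdist (\<phi> (coset_of \<Lambda> x)) (\<phi> (coset_of \<Lambda> y))
        \<le> C * setdist (coset_of \<Lambda> x) (coset_of \<Lambda> y))
      \<Longrightarrow> lipschitz_const (flat_torus \<Lambda>) (flat_torus \<Lambda>') \<phi> \<le> C"
proof -
  let ?Q = "{setdist (\<phi> p) (\<phi> q) / setdist p q | p q.
      p \<in> range (coset_of \<Lambda>) \<and> q \<in> range (coset_of \<Lambda>) \<and> p \<noteq> q}"
  let ?L = "lipschitz_const (flat_torus \<Lambda>) (flat_torus \<Lambda>') \<phi>"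
  have L: "?L = Sup ?Q"
    by (simp add: lipschitz_const_def mspace_flat_torus mdist_flat_torus \<Lambda>)
  have pos: "setdist p q > 0" if "p \<in> range (coset_of \<Lambda>)" "q \<in> range (coset_of \<Lambda>)" "p \<noteq> q" for p q
    using Metric_space.mdist_pos_less[OF Metric_space_flat_torus[OF \<Lambda>(1)] that(3,1,2)] .
  obtain B where B: "\<And>p q. p \<in> range (coset_of \<Lambda>) \<Longrightarrow> q \<in> range (coset_of \<Lambda>) \<Longrightarrow>
      setdist (\<phi> p) (\<phi> q) \<le> B * setdist p q"
    and im: "\<phi> \<in> range (coset_of \<Lambda>) \<rightarrow> range (coset_of \<Lambda>')"
    using lip unfolding Lipschitz_continuous_map_def mspace_flat_torus[OF \<Lambda>(1)]
      mspace_flat_torus[OF \<Lambda>(2)] mdist_flat_torus[OF \<Lambda>(1)] mdist_flat_torus[OF \<Lambda>(2)]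
    by blast
  have bdd: "bdd_above ?Q"
  proof (rule bdd_aboveI[of _ B])
    fix r assume "r \<in> ?Q"
    then obtain p q where r: "r = setdist (\<phi> p) (\<phi> q) / setdist p q"
      and pq: "p \<in> range (coset_of \<Lambda>)" "q \<in> range (coset_of \<Lambda>)" "p \<noteq> q" by blast
    then show "r \<le> B" using B[OF pq(1,2)] pos[OF pq] by (simp add: pos_divide_le_eq)
  qed
  obtain x0 where x0: "coset_of \<Lambda> x0 \<noteq> coset_of \<Lambda> 0" by (rule flat_torus_nontrivial[OF \<Lambda>(1)])
  then have ne: "setdist (\<phi> (coset_of \<Lambda> x0)) (\<phi> (coset_of \<Lambda> 0))
      / setdist (coset_of \<Lambda> x0) (coset_of \<Lambda> 0) \<in> ?Q" by blast
  show "?L \<ge> 0"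
    unfolding L by (rule order_trans[OF _ cSup_upper[OF ne bdd]]) (simp add: setdist_pos_le)
  show "setdist (\<phi> (coset_of \<Lambda> x)) (\<phi> (coset_of \<Lambda> y)) \<le> ?L * setdist (coset_of \<Lambda> x) (coset_of \<Lambda> y)"
  proof (cases "coset_of \<Lambda> x = coset_of \<Lambda> y")
    case True
    have "\<phi> (coset_of \<Lambda> y) \<in> range (coset_of \<Lambda>')" using im by blast
    then show ?thesis
      using True Metric_space.mdist_zero[OF Metric_space_flat_torus[OF \<Lambda>(2)]]
        Metric_space.mdist_zero[OF Metric_space_flat_torus[OF \<Lambda>(1)]] by simp
  next
    case False
    then have "setdist (\<phi> (coset_of \<Lambda> x)) (\<phi> (coset_of \<Lambda> y)) / setdist (coset_of \<Lambda> x) (coset_of \<Lambda> y) \<in> ?Q"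
      by blast
    from cSup_upper[OF this bdd] show ?thesis
      unfolding L[symmetric] using pos[OF _ _ False] by (simp add: pos_divide_le_eq)
  qed
  assume C: "\<And>x y. setdist (\<phi> (coset_of \<Lambda> x)) (\<phi> (coset_of \<Lambda> y))
        \<le> C * setdist (coset_of \<Lambda> x) (coset_of \<Lambda> y)"
  show "?L \<le> C"
    unfolding L
  proof (rule cSup_least)
    fix r assume "r \<in> ?Q"
    then obtain p q where r: "r = setdist (\<phi> p) (\<phi> q) / setdist p q"
      and pq: "p \<in> range (coset_of \<Lambda>)" "q \<in> range (coset_of \<Lambda>)" "p \<noteq> q" by blast
    then show "r \<le> C" using C pos[OF pq] by (auto simp: pos_divide_le_eq)
  qed (use ne in blast)
qed

text \<open>The infimum is attained by the affine map, whose linear part carries one basis to the other.\<close>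

lemma thurston_dist_marked_eq:
  fixes A g g' :: "real ^ 'n ^ 'n"
  assumes m: "(\<Lambda>, f) \<in> marked_tori" and g: "marking_basis \<Lambda> f g" and det: "det g \<noteq> 0"
    and m': "(\<Lambda>', f') \<in> marked_tori" and g': "marking_basis \<Lambda>' f' g'" and det': "det g' \<noteq> 0"
    and A: "A ** transpose g = transpose g'"
  shows "thurston_dist_marked (\<Lambda>, f) (\<Lambda>', f') = ln (onorm ((*v) A))"
proof -
  note \<Lambda> = marked_toriD(1)[OF m] and \<Lambda>' = marked_toriD(1)[OF m']
  let ?S = "flat_torus \<Lambda>" and ?S' = "flat_torus \<Lambda>'"
  let ?M = "marking_change_maps (\<Lambda>, f) (\<Lambda>', f')"
  \<comment> \<open>Points of a torus are cosets, so taking images under \<open>A\<close> is itself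
    the induced map \<open>?\<phi>\<close>; no representatives are chosen.\<close>
  let ?\<psi> = "inv_into (mspace ?S') f' \<circ> f" and ?\<phi> = "(`) ((*v) A)"
  have onto: "f x \<in> f' ` mspace ?S'" if "x \<in> mspace ?S" for x
    using that homeomorphic_imp_surjective_map[OF marked_toriD(2)[OF m]]
      homeomorphic_imp_surjective_map[OF marked_toriD(2)[OF m']] by auto
  have f'\<psi>: "(f' \<circ> ?\<psi>) x = f x" if "x \<in> mspace ?S" for x
    using f_inv_into_f[OF onto[OF that]] by simp
  have f': "continuous_map (mtopology_of ?S') (mtopology_of standard_torus) f'"
    by (rule homeomorphic_imp_continuous_map[OF marked_toriD(2)[OF m']])
  have hom_f: "homotopic_with (\<lambda>_. True) (mtopology_of ?S) (mtopology_of standard_torus) (f' \<circ> \<phi>) f"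
    if "homotopic_with (\<lambda>_. True) (mtopology_of ?S) (mtopology_of ?S') \<phi> ?\<psi>" for \<phi>
    using homotopic_with_compose_continuous_map_left[OF that f', of "\<lambda>_. True"]
    by (rule homotopic_with_eq) (use f'\<psi> in simp_all)
  have lower: "onorm ((*v) A) \<le> lipschitz_const ?S ?S' \<phi>" if "\<phi> \<in> ?M" for \<phi>
  proof (rule onorm_le)
    have \<phi>: "continuous_map (mtopology_of ?S) (mtopology_of ?S') \<phi>" "Lipschitz_continuous_map ?S ?S' \<phi>"
      "homotopic_with (\<lambda>_. True) (mtopology_of ?S) (mtopology_of ?S') \<phi> ?\<psi>"
      using that by (auto simp: marking_change_maps_def homeomorphic_imp_continuous_map)
    fix v :: "real ^ 'n"
    have "invertible (transpose g)" using det by (simp add: invertible_det_nz)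
    \<comment> \<open>With \<open>v\<close> in the form \<open>transpose g *v w\<close>, the vector
      \<open>transpose g' *v w\<close> is \<open>A *v v\<close>, and the norm comparison of the two
      bases becomes a bound on \<open>A\<close>.\<close>
    then have v: "transpose g *v (matrix_inv (transpose g) *v v) = v"
      by (simp add: matrix_vector_mul_assoc invertible_matrix_inv)
    show "norm (A *v v) \<le> lipschitz_const ?S ?S' \<phi> * norm v"
      using marking_change_norm_le[OF m g m' g' \<phi>(1) hom_f[OF \<phi>(3)]
          lipschitz_const_flat_torus(1,2)[OF \<Lambda> \<Lambda>' \<phi>(2)], of "matrix_inv (transpose g) *v v"]
      unfolding v A[symmetric] matrix_vector_mul_assoc[symmetric] by simp
  qed
  have "det A * det g = det g'"
    using arg_cong[OF A, of det] by (simp add: det_mul)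
  then have "invertible A" using det' by (auto simp: invertible_det_nz)
  note invA = invertible_matrix_inv[OF this]
  have AA': "A *v (matrix_inv A *v x) = x" "matrix_inv A *v (A *v x) = x" for x
    by (simp_all add: matrix_vector_mul_assoc invA)
  have im: "(*v) A ` \<Lambda> = \<Lambda>'"
    unfolding marking_basis_lattice[OF m g] marking_basis_lattice[OF m' g']
    by (simp add: image_image matrix_vector_mul_assoc A del: transpose_matrix_vector)
  have im': "(*v) (matrix_inv A) ` \<Lambda>' = \<Lambda>"
    unfolding im[symmetric] by (simp add: image_image AA')
  note lift = torus_lift_image[OF im] and lift' = torus_lift_image[OF im']
  have "homeomorphic_maps (mtopology_of ?S) (mtopology_of ?S') ?\<phi> ((`) ((*v) (matrix_inv A)))"
    using torus_lift_continuous_map[OF \<Lambda> \<Lambda>' lift] torus_lift_continuous_map[OF \<Lambda>' \<Lambda> lift']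
    by (simp add: homeomorphic_maps_def image_image AA')
  then have homeo: "homeomorphic_map (mtopology_of ?S) (mtopology_of ?S') ?\<phi>"
    unfolding homeomorphic_map_maps by blast
  have ineq: "setdist (?\<phi> (coset_of \<Lambda> x)) (?\<phi> (coset_of \<Lambda> y))
      \<le> onorm ((*v) A) * setdist (coset_of \<Lambda> x) (coset_of \<Lambda> y)" for x y
    using setdist_image_coset_of_le[OF \<Lambda> \<Lambda>' im, of x y] lift by (simp add: torus_lift_def)
  have lip: "Lipschitz_continuous_map ?S ?S' ?\<phi>"
    unfolding Lipschitz_continuous_map_def
    using ineq lift by (auto simp: mspace_flat_torus mdist_flat_torus \<Lambda> \<Lambda>' torus_lift_def)
  \<comment> \<open>On the torus \<open>inv_into\<close> agrees with the continuous inverse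
    \<open>k\<close> of \<open>f'\<close>, from which continuity is inherited.\<close>
  have \<psi>: "continuous_map (mtopology_of ?S) (mtopology_of ?S') ?\<psi>"
  proof -
    obtain k where k: "homeomorphic_maps (mtopology_of ?S') (mtopology_of standard_torus) f' k"
      using marked_toriD(2)[OF m'] unfolding homeomorphic_map_maps by blast
    have "continuous_map (mtopology_of ?S) (mtopology_of ?S') (k \<circ> f)"
      using k homeomorphic_imp_continuous_map[OF marked_toriD(2)[OF m]]
      by (intro continuous_map_compose) (auto simp: homeomorphic_maps_def)
    then show ?thesis
    proof (rule continuous_map_eq)
      fix x assume "x \<in> topspace (mtopology_of ?S)"
      then have x: "x \<in> mspace ?S" by simp
      have y: "?\<psi> x \<in> mspace ?S'" using inv_into_into[OF onto[OF x]] by simp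
      have "k (f' (?\<psi> x)) = ?\<psi> x"
        using k y by (simp add: homeomorphic_maps_def)
      then show "(k \<circ> f) x = ?\<psi> x" using f'\<psi>[OF x] by simp
    qed
  qed
  obtain \<Psi> where \<Psi>: "torus_lift \<Lambda> \<Lambda>' ?\<psi> \<Psi>" by (rule torus_lift_exists[OF \<Lambda> \<Lambda>' \<psi>])
  have "homotopic_with (\<lambda>_. True) (mtopology_of ?S) (mtopology_of ?S') ?\<phi> ?\<psi>"
  proof (rule homotopic_of_torus_lift[OF \<Lambda> \<Lambda>' lift \<Psi>])
    fix l assume "l \<in> \<Lambda>"
    then obtain k where k: "k \<in> integer_lattice" "l = transpose g *v k"
      using marking_basis_lattice[OF m g] by blast
    \<comment> \<open>The map \<open>?\<psi>\<close> itself respects the markings, so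
      \<open>marking_change_lift\<close> shows that its lift acts on the lattice as \<open>A\<close>
      does.\<close>
    have "homotopic_with (\<lambda>_. True) (mtopology_of ?S) (mtopology_of ?S') ?\<psi> ?\<psi>"
      using \<psi> by (simp add: homotopic_with_refl)
    from marking_change_lift[OF m g m' g' \<Psi> hom_f[OF this] k(1)]
    show "A *v l - A *v 0 = \<Psi> l - \<Psi> 0"
      by (simp add: k(2) matrix_vector_mul_assoc A del: transpose_matrix_vector)
  qed
  then have mem: "?\<phi> \<in> ?M"
    using homeo lip by (simp add: marking_change_maps_def)
  have "lipschitz_const ?S ?S' ?\<phi> = onorm ((*v) A)"
    by (rule antisym[OF lipschitz_const_flat_torus(3)[OF \<Lambda> \<Lambda>' lip ineq] lower[OF mem]])
  then have "(INF \<phi>\<in>?M. lipschitz_const ?S ?S' \<phi>) = onorm ((*v) A)"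
    using lower by (intro cInf_eq_minimum rev_image_eqI[OF mem]) auto
  then show ?thesis by (simp add: thurston_dist_marked_def)
qed

section \<open>Eigenvalues of Gram matrices\<close>

lemma map_matrix_of_real_mult:
  fixes A :: "real ^ 'n ^ 'm" and B :: "real ^ 'k ^ 'n"
  shows "map_matrix complex_of_real (A ** B) = map_matrix complex_of_real A ** map_matrix complex_of_real B"
  by (simp add: vec_eq_iff map_matrix_def matrix_matrix_mult_def)

lemma map_matrix_of_real_mat: "map_matrix complex_of_real (mat 1) = mat 1"
  by (simp add: vec_eq_iff map_matrix_def mat_def)

text \<open>The matrix \<open>g\<close> maps eigenvectors of \<open>S\<close> to eigenvectors of
  \<open>M\<close>; its left inverse \<open>h\<close> keeps them nonzero.\<close>

lemma eigenvalues_intertwine_subset: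
  fixes M S g h :: "real ^ 'n ^ 'n"
  assumes "M ** g = g ** S" "h ** g = mat 1"
  shows "eigenvalues S \<subseteq> eigenvalues M"
proof
  let ?c = "map_matrix complex_of_real"
  fix \<mu> assume "\<mu> \<in> eigenvalues S"
  then obtain v where v: "v \<noteq> 0" "?c S *v v = \<mu> *s v" by (auto simp: eigenvalues_def)
  have "?c h *v (?c g *v v) = v"
    by (simp add: matrix_vector_mul_assoc map_matrix_of_real_mat assms(2) flip: map_matrix_of_real_mult)
  then have "?c g *v v \<noteq> 0" using v(1) by auto
  moreover have "?c M *v (?c g *v v) = ?c g *v (?c S *v v)"
    by (simp add: matrix_vector_mul_assoc assms(1) flip: map_matrix_of_real_mult)
  ultimately show "\<mu> \<in> eigenvalues M"
    unfolding eigenvalues_def v(2) by (auto simp: vector_scalar_commute)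
qed

lemma eigenvalues_similar:
  fixes M S g :: "real ^ 'n ^ 'n"
  assumes "invertible g" "M ** g = g ** S"
  shows "eigenvalues M = eigenvalues S"
proof
  note inv = invertible_matrix_inv[OF assms(1)]
  show "eigenvalues S \<subseteq> eigenvalues M"
    by (rule eigenvalues_intertwine_subset[OF assms(2) inv(2)])
  have "S ** matrix_inv g = matrix_inv g ** (g ** S) ** matrix_inv g"
    by (simp add: matrix_mul_assoc inv)
  also have "\<dots> = matrix_inv g ** M"
    unfolding assms(2)[symmetric] by (simp add: inv flip: matrix_mul_assoc)
  finally show "eigenvalues M \<subseteq> eigenvalues S"
    by (rule eigenvalues_intertwine_subset[OF _ inv(1)])
qed

lemma symmetric_matrix_inner:
  fixes S :: "real ^ 'n ^ 'n"
  assumes "transpose S = S"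
  shows "(S *v x) \<bullet> y = x \<bullet> (S *v y)"
  using dot_lmul_matrix[of x S y] transpose_matrix_vector[of S x] assms by simp

lemma eigenvalues_symmetric:
  fixes S :: "real ^ 'n ^ 'n"
  assumes S: "transpose S = S"
  shows "eigenvalues S = complex_of_real ` {l. \<exists>w. w \<noteq> 0 \<and> S *v w = l *\<^sub>R w}"
proof (intro equalityI subsetI)
  fix \<mu> assume "\<mu> \<in> eigenvalues S"
  then obtain v where v: "v \<noteq> 0" "map_matrix complex_of_real S *v v = \<mu> *s v"
    by (auto simp: eigenvalues_def)
  define a b where "a = (\<chi> i. Re (v $ i))" and "b = (\<chi> i. Im (v $ i))"
  have comp: "(\<Sum>j\<in>UNIV. complex_of_real (S $ i $ j) * v $ j) = \<mu> * v $ i" for i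
    using arg_cong[OF v(2), of "\<lambda>x. x $ i"]
    by (simp add: map_matrix_def matrix_vector_mult_def)
  \<comment> \<open>Real and imaginary parts of the eigenvector equation. Symmetry of
    \<open>S\<close>, tested on the pair \<open>a\<close>, \<open>b\<close>, then forces
    \<open>Im \<mu>\<close> to vanish, and a nonzero one of \<open>a\<close>, \<open>b\<close> is a
    real eigenvector.\<close>
  have Sa: "S *v a = Re \<mu> *\<^sub>R a - Im \<mu> *\<^sub>R b"
    using arg_cong[OF comp, of Re] by (simp add: vec_eq_iff a_def b_def matrix_vector_mult_def)
  have Sb: "S *v b = Re \<mu> *\<^sub>R b + Im \<mu> *\<^sub>R a"
    using arg_cong[OF comp, of Im] by (simp add: vec_eq_iff a_def b_def matrix_vector_mult_def)
  have ab: "a \<noteq> 0 \<or> b \<noteq> 0"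
    using v(1) by (auto simp: vec_eq_iff a_def b_def complex_eq_iff)
  have "Im \<mu> * (a \<bullet> a + b \<bullet> b) = 0"
    using symmetric_matrix_inner[OF S, of a b] unfolding Sa Sb
    by (simp add: inner_simps inner_commute algebra_simps)
  moreover have "a \<bullet> a + b \<bullet> b > 0"
    using ab by (metis add_nonneg_pos add_pos_nonneg inner_ge_zero inner_gt_zero_iff)
  ultimately have "Im \<mu> = 0" by simp
  then have "\<mu> = complex_of_real (Re \<mu>)" "\<exists>w. w \<noteq> 0 \<and> S *v w = Re \<mu> *\<^sub>R w"
    using ab Sa Sb by (auto simp: complex_eq_iff)
  then show "\<mu> \<in> complex_of_real ` {l. \<exists>w. w \<noteq> 0 \<and> S *v w = l *\<^sub>R w}" by blast
next
  fix \<mu> assume "\<mu> \<in> complex_of_real ` {l. \<exists>w. w \<noteq> 0 \<and> S *v w = l *\<^sub>R w}"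
  then obtain l w where w: "\<mu> = complex_of_real l" "w \<noteq> 0" "S *v w = l *\<^sub>R w" by blast
  define v where "v = (\<chi> i. complex_of_real (w $ i))"
  have "map_matrix complex_of_real S *v v = \<mu> *s v"
    using arg_cong[OF w(3), of "\<lambda>x. complex_of_real (x $ i)" for i]
    by (simp add: vec_eq_iff v_def w(1) map_matrix_def matrix_vector_mult_def)
  moreover have "v \<noteq> 0" using w(2) by (simp add: v_def vec_eq_iff)
  ultimately show "\<mu> \<in> eigenvalues S" by (auto simp: eigenvalues_def)
qed

text \<open>Eigenvectors for distinct eigenvalues are orthogonal, hence independent. Finiteness
  gives \<open>Max\<close> its meaning.\<close>

lemma finite_eigenvalues_symmetric:
  fixes S :: "real ^ 'n ^ 'n"
  assumes S: "transpose S = S"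
  shows "finite {l. \<exists>w. w \<noteq> 0 \<and> S *v w = l *\<^sub>R w}" (is "finite ?E")
proof -
  define w where "w l = (SOME w. w \<noteq> 0 \<and> S *v w = l *\<^sub>R w)" for l
  have w: "w l \<noteq> 0" "S *v w l = l *\<^sub>R w l" if "l \<in> ?E" for l
  proof -
    have "\<exists>w. w \<noteq> 0 \<and> S *v w = l *\<^sub>R w" using that by simp
    from someI_ex[OF this] show "w l \<noteq> 0" "S *v w l = l *\<^sub>R w l"
      unfolding w_def by simp_all
  qed
  have orth: "w l \<bullet> w k = 0" if "l \<in> ?E" "k \<in> ?E" "l \<noteq> k" for l k
    using symmetric_matrix_inner[OF S, of "w l" "w k"] that(3) by (simp add: w(2)[OF that(1)] w(2)[OF that(2)])
  have inj: "inj_on w ?E"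
    proof (rule inj_onI, rule ccontr)
    fix l k assume lk: "l \<in> ?E" "k \<in> ?E" "w l = w k" "l \<noteq> k"
    then show False using orth[OF lk(1,2,4)] w(1)[OF lk(1)] by simp
  qed
  have "pairwise orthogonal (w ` ?E)"
    using orth by (auto simp: pairwise_def orthogonal_def)
  moreover have "0 \<notin> w ` ?E" by (rule notI, erule imageE, drule w(1)) simp
  ultimately have "independent (w ` ?E)" by (rule pairwise_orthogonal_independent)
  then have "finite (w ` ?E)" by (rule independent_imp_finite)
  then show ?thesis using inj by (simp add: finite_image_iff)
qed

text \<open>If \<open>v\<close> is a unit vector at which \<open>\<bar>A v\<bar>\<close> attains the operator norm \<open>K\<close>, then
  \<open>\<bar>A\<^sup>T A v - K\<^sup>2 v\<bar>\<^sup>2 = \<bar>A\<^sup>T A v\<bar>\<^sup>2 - K\<^sup>4 \<le> K\<^sup>2 \<bar>A v\<bar>\<^sup>2 - K\<^sup>4 = 0\<close>.\<close>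

lemma onorm_eigenvector:
  fixes A :: "real ^ 'n ^ 'n"
  obtains v where "v \<noteq> 0" "(transpose A ** A) *v v = (onorm ((*v) A))\<^sup>2 *\<^sub>R v"
proof -
  let ?K = "onorm ((*v) A)"
  have bl: "bounded_linear ((*v) A)" by simp
  obtain e :: "real ^ 'n" where "norm e = 1" using vector_choose_size[of 1] by auto
  then have "sphere (0 :: real ^ 'n) 1 \<noteq> {}" by (auto intro!: exI[of _ e])
  moreover have "continuous_on (sphere (0 :: real ^ 'n) 1) (\<lambda>v. norm (A *v v))"
    by (intro continuous_on_norm matrix_vector_mult_linear_continuous_on)
  ultimately obtain v where v: "norm v = 1" "\<And>u. norm u = 1 \<Longrightarrow> norm (A *v u) \<le> norm (A *v v)"
    using continuous_attains_sup[OF compact_sphere, of 0 1 "\<lambda>v. norm (A *v v)"] by auto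
  have "norm (A *v u) \<le> norm (A *v v) * norm u" for u
  proof (cases "u = 0")
    case False
    then have "norm (A *v ((1 / norm u) *\<^sub>R u)) \<le> norm (A *v v)" by (intro v(2)) simp
    then show ?thesis using False by (simp add: matrix_vector_mult_scaleR field_simps)
  qed simp
  then have "?K \<le> norm (A *v v)" by (rule onorm_le)
  moreover have "norm (A *v v) \<le> ?K" using onorm[OF bl, of v] v(1) by simp
  ultimately have K: "norm (A *v v) = ?K" by simp
  have adj: "(transpose A *v x) \<bullet> y = x \<bullet> (A *v y)" for x y
    using dot_lmul_matrix[of x A y] by simp
  \<comment> \<open>The transpose obeys the same bound: Cauchy-Schwarz bounds the square of the left
    side, and one factor \<open>norm (transpose A *v w)\<close> cancels when it is nonzero.\<close>
  have tr: "norm (transpose A *v w) \<le> ?K * norm w" for w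
  proof (cases "transpose A *v w = 0")
    case True
    then show ?thesis using onorm_pos_le[OF bl] by simp
  next
    case False
    have "(norm (transpose A *v w))\<^sup>2 = w \<bullet> (A *v (transpose A *v w))"
      unfolding power2_norm_eq_inner by (rule adj)
    also have "\<dots> \<le> norm w * norm (A *v (transpose A *v w))" by (rule norm_cauchy_schwarz)
    also have "\<dots> \<le> norm w * (?K * norm (transpose A *v w))"
      by (rule mult_left_mono[OF onorm[OF bl]]) simp
    finally show ?thesis using False by (simp add: power2_eq_square mult_ac)
  qed
  let ?u = "transpose A *v (A *v v)"
  have "(norm (?u - ?K\<^sup>2 *\<^sub>R v))\<^sup>2 = (norm ?u)\<^sup>2 - 2 * ?K\<^sup>2 * (?u \<bullet> v) + (?K\<^sup>2)\<^sup>2 * (norm v)\<^sup>2"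
    unfolding power2_norm_eq_inner by (simp add: inner_simps inner_commute algebra_simps power2_eq_square)
  also have "?u \<bullet> v = ?K\<^sup>2" unfolding adj K[symmetric] power2_norm_eq_inner ..
  also have "(norm ?u)\<^sup>2 \<le> (?K * ?K)\<^sup>2" using tr[of "A *v v"] unfolding K by (intro power_mono) auto
  finally have "(norm (?u - ?K\<^sup>2 *\<^sub>R v))\<^sup>2 \<le> 0" using v(1) by (simp add: power2_eq_square)
  then have "?u = ?K\<^sup>2 *\<^sub>R v" by simp
  then show thesis
    using v(1) by (intro that[of v]) (auto simp: matrix_vector_mul_assoc)
qed

text \<open>An eigenvalue with eigenvector \<open>w\<close> is the squared ratio of
  \<open>norm (A *v w)\<close> to \<open>norm w\<close>. It is positive as \<open>A\<close> is
  injective and at most the squared operator norm, which \<open>onorm_eigenvector\<close>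
  attains.\<close>

lemma Max_ln_eigenvalues_gram:
  fixes A :: "real ^ 'n ^ 'n"
  assumes "invertible A"
  shows "Max {ln (cmod \<mu>) | \<mu>. \<mu> \<in> eigenvalues (transpose A ** A)} = 2 * ln (onorm ((*v) A))"
proof -
  let ?K = "onorm ((*v) A)" and ?S = "transpose A ** A"
  let ?E = "{l. \<exists>w. w \<noteq> 0 \<and> ?S *v w = l *\<^sub>R w}"
  have S: "transpose ?S = ?S" by (simp add: matrix_transpose_mul)
  have inj: "A *v w \<noteq> 0" if "w \<noteq> 0" for w
    using inj_matrix_vector_mult[OF assms] that by (metis injD matrix_vector_mult_0_right)
  have E: "0 < l \<and> l \<le> ?K\<^sup>2" if l: "l \<in> ?E" for l
  proof -
    obtain w where w: "w \<noteq> 0" "?S *v w = l *\<^sub>R w" using l by blast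
    have "l * (norm w)\<^sup>2 = (?S *v w) \<bullet> w"
      unfolding w(2) by (simp add: power2_norm_eq_inner)
    also have "\<dots> = (norm (A *v w))\<^sup>2"
      using dot_lmul_matrix[of "A *v w" A w]
      by (simp add: power2_norm_eq_inner flip: matrix_vector_mul_assoc)
    finally have l: "l * (norm w)\<^sup>2 = (norm (A *v w))\<^sup>2" .
    have "0 < l * (norm w)\<^sup>2" unfolding l using inj[OF w(1)] by simp
    moreover have "l * (norm w)\<^sup>2 \<le> ?K\<^sup>2 * (norm w)\<^sup>2"
      unfolding l power_mult_distrib[symmetric] by (intro power_mono onorm) simp_all
    ultimately show ?thesis using w(1) by (simp add: zero_less_mult_iff)
  qed
  obtain v where v: "v \<noteq> 0" "?S *v v = ?K\<^sup>2 *\<^sub>R v" by (rule onorm_eigenvector)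
  then have KE: "?K\<^sup>2 \<in> ?E" by blast
  then have "?K\<^sup>2 > 0" using E by blast
  moreover have "?K \<ge> 0" by (rule onorm_pos_le) simp
  ultimately have K: "?K > 0" by (simp add: less_le)
  have "{ln (cmod \<mu>) | \<mu>. \<mu> \<in> eigenvalues ?S} = (\<lambda>l. ln \<bar>l\<bar>) ` ?E"
    unfolding eigenvalues_symmetric[OF S] Setcompr_eq_image image_image norm_of_real ..
  moreover have "Max ((\<lambda>l. ln \<bar>l\<bar>) ` ?E) = ln (?K\<^sup>2)"
  proof (rule Max_eqI)
    show "finite ((\<lambda>l. ln \<bar>l\<bar>) ` ?E)" using finite_eigenvalues_symmetric[OF S] by (rule finite_imageI)
    show "ln (?K\<^sup>2) \<in> (\<lambda>l. ln \<bar>l\<bar>) ` ?E" using KE by (rule rev_image_eqI) simp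
    fix y assume "y \<in> (\<lambda>l. ln \<bar>l\<bar>) ` ?E"
    then obtain l where l: "y = ln \<bar>l\<bar>" "l \<in> ?E" by blast
    show "y \<le> ln (?K\<^sup>2)" using E[OF l(2)] \<open>?K\<^sup>2 > 0\<close> unfolding l(1) by simp
  qed
  ultimately show ?thesis using K by (simp add: ln_realpow)
qed

section \<open>Thurston's metric\<close>

text \<open>While \<open>corresponds_to\<close> speaks of some representative, every representative
  has a basis with Gram matrix \<open>Y\<close>: both are compared, through
  \<open>marking_rel_gram\<close>, with the marked torus that generates the class.\<close>

lemma teichmueller_space_gram:
  assumes p: "p \<in> teichmueller_space" and Y: "corresponds_to p Y" and m: "(\<Lambda>, f) \<in> p"
  obtains g where "(\<Lambda>, f) \<in> marked_tori" "marking_basis \<Lambda> f g" "Y = g ** transpose g"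
proof -
  obtain \<Lambda>0 f0 where p: "p = marking_rel `` {(\<Lambda>0, f0)}" and m0: "(\<Lambda>0, f0) \<in> marked_tori"
    using p unfolding teichmueller_space_def by (auto elim: quotientE)
  obtain \<Lambda>1 f1 g1 where m1: "(\<Lambda>1, f1) \<in> p" and g1: "marking_basis \<Lambda>1 f1 g1" "Y = g1 ** transpose g1"
    using Y unfolding corresponds_to_def marking_basis_def by fast
  have rel: "((\<Lambda>0, f0), (\<Lambda>, f)) \<in> marking_rel" and rel1: "((\<Lambda>0, f0), (\<Lambda>1, f1)) \<in> marking_rel"
    using m m1 unfolding p by blast+
  then have mt: "(\<Lambda>, f) \<in> marked_tori" by (simp add: marking_rel_def)
  obtain g0 where g0: "marking_basis \<Lambda>0 f0 g0" by (rule marking_basis_exists[OF m0])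
  obtain g where g: "marking_basis \<Lambda> f g" by (rule marking_basis_exists[OF mt])
  show thesis
    using marking_rel_gram[OF rel g0 g] marking_rel_gram[OF rel1 g0 g1(1)] g1(2)
    by (intro that[OF mt g]) simp
qed

lemma spd_gram_det_nz:
  assumes "Y \<in> spd_matrices" "Y = g ** transpose g"
  shows "det g \<noteq> 0"
proof
  assume "det g = 0"
  then have "det Y = 0" by (simp add: assms(2) det_mul)
  then show False using assms(1) by (simp add: spd_matrices_def)
qed

text \<open>Since \<open>g'\<close> equals \<open>g ** transpose A\<close>, the second Gram matrix
  is \<open>g ** transpose A ** A ** transpose g\<close>. Multiplying by the inverse of the first
  leaves a conjugate of \<open>transpose A ** A\<close> by \<open>g\<close>.\<close>

lemma gram_quotient_intertwine:
  fixes A g :: "real ^ 'n ^ 'n"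
  assumes A: "A ** transpose g = transpose g'" and g: "det g \<noteq> 0"
  shows "(g' ** transpose g' ** matrix_inv (g ** transpose g)) ** g = g ** (transpose A ** A)"
proof -
  let ?Y = "g ** transpose g"
  have "invertible ?Y" using g by (simp add: invertible_det_nz det_mul)
  then have "g ** (transpose g ** matrix_inv ?Y) = mat 1"
    by (simp add: matrix_mul_assoc invertible_matrix_inv)
  then have inv: "(transpose g ** matrix_inv ?Y) ** g = mat 1"
    by (rule matrix_left_right_inverse[THEN iffD1])
  have "g' = g ** transpose A"
    using arg_cong[OF A, of transpose] by (simp add: matrix_transpose_mul)
  then have "(g' ** transpose g' ** matrix_inv ?Y) ** g
      = g ** transpose A ** A ** ((transpose g ** matrix_inv ?Y) ** g)"
    unfolding A[symmetric] by (simp only: matrix_mul_assoc)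
  then show ?thesis by (simp add: inv matrix_mul_assoc)
qed

theorem theorem5p4:
  fixes Y X :: "real ^ 'n ^ 'n" and p q :: "'n::finite marking set"
  assumes "CARD('n) \<ge> 2"
    and "Y \<in> spd_matrices" and "X \<in> spd_matrices"
    and "p \<in> teichmueller_space" and "corresponds_to p Y"
    and "q \<in> teichmueller_space" and "corresponds_to q X"
  shows "thurston_dist p q
      = 1 / 2 * Max {ln (cmod \<mu>) | \<mu>. \<mu> \<in> eigenvalues (X ** matrix_inv Y)}"
proof -
  let ?R = "1 / 2 * Max {ln (cmod \<mu>) | \<mu>. \<mu> \<in> eigenvalues (X ** matrix_inv Y)}"
  \<comment> \<open>All pairs of representatives give the same value, so the image in
    \<open>thurston_dist\<close> is a singleton, as \<open>the_elem\<close> requires.\<close>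
  have R: "thurston_dist_marked (\<Lambda>, f) (\<Lambda>', f') = ?R"
    if m: "(\<Lambda>, f) \<in> p" and m': "(\<Lambda>', f') \<in> q" for \<Lambda> f \<Lambda>' f'
  proof -
    obtain g where g: "(\<Lambda>, f) \<in> marked_tori" "marking_basis \<Lambda> f g" "Y = g ** transpose g"
      by (rule teichmueller_space_gram[OF assms(4,5) m])
    obtain g' where g': "(\<Lambda>', f') \<in> marked_tori" "marking_basis \<Lambda>' f' g'" "X = g' ** transpose g'"
      by (rule teichmueller_space_gram[OF assms(6,7) m'])
    have det: "det g \<noteq> 0" and det': "det g' \<noteq> 0"
      by (rule spd_gram_det_nz[OF assms(2) g(3)], rule spd_gram_det_nz[OF assms(3) g'(3)])
    have inv: "invertible g" "invertible (transpose g)" using det by (simp_all add: invertible_det_nz)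
    \<comment> \<open>This is the linear map that carries each marking vector \<open>g $ i\<close>
      to \<open>g' $ i\<close>.\<close>
    define A where "A = transpose g' ** matrix_inv (transpose g)"
    have A: "A ** transpose g = transpose g'"
      by (simp add: A_def invertible_matrix_inv(2)[OF inv(2)] flip: matrix_mul_assoc)
    have "det A * det g = det g'"
      using arg_cong[OF A, of det] by (simp add: det_mul)
    then have "invertible A" using det' by (auto simp: invertible_det_nz)
    moreover have "eigenvalues (X ** matrix_inv Y) = eigenvalues (transpose A ** A)"
      unfolding g(3) g'(3) by (rule eigenvalues_similar[OF inv(1) gram_quotient_intertwine[OF A det]])
    ultimately show ?thesis
      using thurston_dist_marked_eq[OF g(1,2) det g'(1,2) det' A] Max_ln_eigenvalues_gram[of A] by simp
  qed
  let ?d = "\<lambda>(m, m'). thurston_dist_marked m m'"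
  have "?d z = ?R" if "z \<in> p \<times> q" for z
    using that R by (cases z; cases "fst z"; cases "snd z") simp
  then have "?d ` (p \<times> q) = (\<lambda>_. ?R) ` (p \<times> q)"
    by (rule image_cong[OF refl])
  moreover have "p \<noteq> {}" "q \<noteq> {}" using assms(5,7) by (auto simp: corresponds_to_def)
  ultimately have "?d ` (p \<times> q) = {?R}"
    unfolding image_constant_conv by simp
  then show ?thesis by (simp add: thurston_dist_def)
qed

end
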